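(* The finite energy space $\mathcal H=\mathcal H_E$ admits the decomposition into the orthogonal sum $$\mathcal H=\overline{\mathcal D}_{\mathrm{fin}}\oplus\mathcal{H}arm_E,$$ where $\overline{\mathcal D}_{\mathrm{fin}}$ is the closure of $\mathcal D_{\mathrm{fin}}$ in $\mathcal H$. A function $h\in\mathcal H_E$ is harmonic if and only if $$\langle h,f-P(f)\rangle_{\mathcal H_E}=0\qquad\text{for all } f\in\mathcal D_{\mathrm{fin}}.$$
   Context: $(V,\mathcal B,\mu)$ is a standard Borel space with a non-atomic infinite $\sigma$-finite measure $\mu$; $\mathcal D_{\mathrm{fin}}=\mathrm{Span}\{\chi_A:A\in\mathcal B,\ \mu(A)<\infty\}$. $\rho$ is a $\sigma$-finite symmetric measure on $(V\times V,\mathcal B\times\mathcal B)$, i.e. $\rho(A\times B)=\rho(B\times A)$ for all $A,B\in\mathcal B$, supported by a symmetric Borel set $E\subset V\times V$, and disintegrated with respect to $\mu$: there is a measurable family $x\mapsto\rho_x$ of measures on $(V,\mathcal B)$, with $\rho_x$ supported by $E_x=\{y:(x,y)\in E\}$, such that $\iint f\,d\rho=\int_V\big(\int_V f(x,y)\,d\rho_x(y)\big)d\mu(x)$. The measure $\rho$ is irreducible: for $\mu$-a.e. $x$, $E_x$ is nonempty and uncountable and $(E_x,\rho_x)$ is a standard (non-atomic) measure space. Put $c(x)=\rho_x(V)$; it is assumed that $0<c(x)<\infty$ for $\mu$-a.e. $x$ and $\int_A c\,d\mu<\infty$ whenever $\mu(A)<\infty$ (under this assumption $\mathcal D_{\mathrm{fin}}\subset\mathcal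 H_E$). The Markov operator is $P(f)(x)=\frac1{c(x)}\int_V f(y)\,d\rho_x(y)$; a function is harmonic if $P(f)=f$. The finite energy space $\mathcal H_E$ is the Hilbert space of Borel functions $f:V\to\mathbb R$, modulo constants, with $\iint_{V\times V}(f(x)-f(y))^2\,d\rho<\infty$ and inner product $\langle f,g\rangle_{\mathcal H_E}=\frac12\iint_{V\times V}(f(x)-f(y))(g(x)-g(y))\,d\rho(x,y)$; $\mathcal{H}arm_E=\{f\in\mathcal H_E:P(f)=f\}$. *)

theory Defs
  imports "HOL-Analysis.Analysis"
begin

definition nonatomic :: "'a measure \<Rightarrow> bool" where
  "nonatomic M \<longleftrightarrow>
     (\<forall>A\<in>sets M. emeasure M A > 0 \<longrightarrow>
        (\<exists>B\<in>sets M. B \<subseteq> A \<and> 0 < emeasure M B \<and> emeasure M B < emeasure M A))"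

text \<open>
  The standard Borel space is a type of class \<open>polish_space\<close> with its Borel sets.  \<open>K x\<close> is the
  fibre measure \<open>\<rho>\<^sub>x\<close>, and \<open>c x = emeasure (K x) UNIV\<close>.  In the irreducibility condition nothing
  has to be said about \<open>E\<^sub>x\<close> being standard Borel: it is a Borel subset of a Polish space.
\<close>

locale symmetric_measure_setting =
  fixes \<mu> :: "'a::polish_space measure"
    and \<rho> :: "('a \<times> 'a) measure"
    and E :: "('a \<times> 'a) set"
    and K :: "'a \<Rightarrow> 'a measure"
  assumes sets_mu: "sets \<mu> = sets borel"
    and sigma_finite_mu: "sigma_finite_measure \<mu>"
    and nonatomic_mu: "nonatomic \<mu>"
    and infinite_mu: "emeasure \<mu> UNIV = \<infinity>"
    and sets_rho: "sets \<rho> = sets (borel \<Otimes>\<^sub>M borel)"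
    and sigma_finite_rho: "sigma_finite_measure \<rho>"
    and symmetric_rho:
      "\<And>A B. A \<in> sets borel \<Longrightarrow> B \<in> sets borel \<Longrightarrow> emeasure \<rho> (A \<times> B) = emeasure \<rho> (B \<times> A)"
    and E_borel: "E \<in> sets (borel \<Otimes>\<^sub>M borel)"
    and E_sym: "sym E"
    and rho_supported: "emeasure \<rho> (- E) = 0"
    and sets_K: "\<And>x. sets (K x) = sets borel"
    and measurable_K: "\<And>B. B \<in> sets borel \<Longrightarrow> (\<lambda>x. emeasure (K x) B) \<in> borel_measurable borel"
    and K_supported: "AE x in \<mu>. emeasure (K x) (- (E `` {x})) = 0"
    and disintegration:
      "\<And>f :: 'a \<times> 'a \<Rightarrow> ennreal. f \<in> borel_measurable (borel \<Otimes>\<^sub>M borel) \<Longrightarrow>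
         (\<integral>\<^sup>+ z. f z \<partial>\<rho>) = (\<integral>\<^sup>+ x. (\<integral>\<^sup>+ y. f (x, y) \<partial>K x) \<partial>\<mu>)"
    and irreducible:
      "AE x in \<mu>. E `` {x} \<noteq> {} \<and> uncountable (E `` {x}) \<and> nonatomic (restrict_space (K x) (E `` {x}))"
    and c_pos_finite: "AE x in \<mu>. 0 < emeasure (K x) UNIV \<and> emeasure (K x) UNIV < \<infinity>"
    and c_locally_integrable:
      "\<And>A. A \<in> sets borel \<Longrightarrow> emeasure \<mu> A < \<infinity> \<Longrightarrow>
         (\<integral>\<^sup>+ x\<in>A. emeasure (K x) UNIV \<partial>\<mu>) < \<infinity>"

definition D_fin :: "'a measure \<Rightarrow> ('a \<Rightarrow> real) set" where
  "D_fin \<mu> = {\<lambda>x. \<Sum>A\<in>F. a A * indicator A x | F a.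
                finite F \<and> F \<subseteq> {A \<in> sets \<mu>. emeasure \<mu> A < \<infinity>}}"

definition markov_op :: "('a \<Rightarrow> 'a measure) \<Rightarrow> ('a \<Rightarrow> real) \<Rightarrow> 'a \<Rightarrow> real" where
  "markov_op K f x = (1 / measure (K x) UNIV) * (\<integral>y. f y \<partial>K x)"

text \<open>
  Elements of the finite energy space are handled through representing functions.  A vector is
  zero when its energy norm is zero.  All \<open>\<mu>\<close>-almost everywhere constant functions have energy
  norm zero; the converse is \<open>definite_mod_constants\<close>, which is what makes the energy form an
  inner product on functions modulo constants.  It does not follow from the irreducibility
  condition above (\<open>\<rho>\<close> may live on \<open>A \<times> A \<union> (- A) \<times> (- A)\<close>, and then the indicator of \<open>A\<close> has norm
  zero), so it is not built into the notion of zero vector.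
\<close>

definition finite_energy :: "('a::topological_space \<times> 'a) measure \<Rightarrow> ('a \<Rightarrow> real) set" where
  "finite_energy \<rho> =
     {f \<in> borel_measurable borel. (\<integral>\<^sup>+ z. ennreal ((f (fst z) - f (snd z))\<^sup>2) \<partial>\<rho>) < \<infinity>}"

definition energy_inner :: "('a \<times> 'a) measure \<Rightarrow> ('a \<Rightarrow> real) \<Rightarrow> ('a \<Rightarrow> real) \<Rightarrow> real" where
  "energy_inner \<rho> f g =
     (1 / 2) * (\<integral>z. (f (fst z) - f (snd z)) * (g (fst z) - g (snd z)) \<partial>\<rho>)"

definition energy_norm :: "('a \<times> 'a) measure \<Rightarrow> ('a \<Rightarrow> real) \<Rightarrow> real" where
  "energy_norm \<rho> f = sqrt (energy_inner \<rho> f f)"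

definition definite_mod_constants ::
    "'a::topological_space measure \<Rightarrow> ('a \<times> 'a) measure \<Rightarrow> bool" where
  "definite_mod_constants \<mu> \<rho> \<longleftrightarrow>
     (\<forall>f\<in>finite_energy \<rho>. energy_norm \<rho> f = 0 \<longrightarrow> (\<exists>k. AE x in \<mu>. f x = k))"

definition energy_closure ::
    "('a::topological_space \<times> 'a) measure \<Rightarrow> ('a \<Rightarrow> real) set \<Rightarrow> ('a \<Rightarrow> real) set" where
  "energy_closure \<rho> D =
     {f \<in> finite_energy \<rho>. \<forall>\<epsilon>>0. \<exists>g\<in>D. energy_norm \<rho> (\<lambda>x. f x - g x) < \<epsilon>}"

definition Harm ::
    "'a::topological_space measure \<Rightarrow> ('a \<times> 'a) measure \<Rightarrow> ('a \<Rightarrow> 'a measure) \<Rightarrow> ('a \<Rightarrow> real) set" where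
  "Harm \<mu> \<rho> K = {f \<in> finite_energy \<rho>. AE x in \<mu>. markov_op K f x = f x}"

definition energy_orthogonal_sum ::
    "('a::topological_space \<times> 'a) measure \<Rightarrow> ('a \<Rightarrow> real) set \<Rightarrow> ('a \<Rightarrow> real) set \<Rightarrow> bool" where
  "energy_orthogonal_sum \<rho> A B \<longleftrightarrow>
     A \<subseteq> finite_energy \<rho> \<and> B \<subseteq> finite_energy \<rho> \<and>
     (\<forall>f\<in>finite_energy \<rho>. \<exists>a\<in>A. \<exists>b\<in>B. f = (\<lambda>x. a x + b x)) \<and>
     (\<forall>a\<in>A. \<forall>b\<in>B. energy_inner \<rho> a b = 0) \<and>
     (\<forall>f\<in>A \<inter> B. energy_norm \<rho> f = 0)"

end

theory Submission
  imports Defs "HOL-Probability.Giry_Monad"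
begin

text \<open>
  If the energy space were complete, the theorem would be the projection theorem together with the
  identity \<open>\<langle>h, g\<rangle> = \<integral> c (h - P h) g d\<mu>\<close> for \<open>g\<close> in \<open>L\<^sup>2(c \<mu>)\<close>, which says that the harmonic functions are
  the orthogonal complement of \<open>\<D>\<^sub>f\<^sub>i\<^sub>n\<close>.  The energy space need not be complete, however: the gradients
  \<open>(x, y) \<mapsto> f x - f y\<close> need not be closed in \<open>L\<^sup>2(\<rho>)\<close>, for instance when they are the coboundaries of an
  ergodic conservative transformation that preserves an infinite measure: square integrable
  coboundaries are then dense in \<open>L\<^sup>2\<close>, but a positive function is never a coboundary.  So the
  orthogonal projection of a given \<open>f\<close> onto the closure of \<open>\<D>\<^sub>f\<^sub>i\<^sub>n\<close> has to be shown to exist as a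
  function.

  This is done by a dichotomy between recurrence and transience.  A minimising sequence \<open>u\<^sub>n\<close> in
  \<open>L\<^sup>2(c \<mu>)\<close> can be chosen with increments of energy norm at most \<open>2\<^sup>-\<^sup>n\<close>.  Let \<open>Z\<close> be the set on which the
  increments are not absolutely summable.  The partial sums \<open>S\<^sub>N\<close> of their absolute values have bounded
  energy, so \<open>S\<^sub>N x - S\<^sub>N y\<close> cannot tend to infinity on a set of positive \<open>\<rho>\<close>-measure, and therefore
  \<open>Z\<close> is invariant under \<open>\<rho>\<close> (\<open>rho_invariant_explosion\<close>).  Off \<open>Z\<close> the functions \<open>u\<^sub>n\<close> converge pointwise,
  and Fatou's lemma makes their limit a limit in energy.  On \<open>Z\<close> the functions \<open>min 1 (S\<^sub>N / k)\<close> converge to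
  \<open>1\<close> with energy norm at most of order \<open>1 / k\<close>, so \<open>Z\<close> is recurrent and every finite energy function
  restricted to \<open>Z\<close> already lies in the closure of \<open>\<D>\<^sub>f\<^sub>i\<^sub>n\<close> (\<open>recurrent_approx\<close>).  Hence the projection of
  \<open>f\<close> is \<open>f\<close> itself on \<open>Z\<close> and \<open>lim u\<^sub>n\<close> off \<open>Z\<close> (\<open>orthogonal_projection_exists\<close>).

  For the characterisation of harmonic functions put \<open>\<phi> = h - P h\<close>.  Jensen's inequality on the
  fibres gives \<open>\<phi> \<in> L\<^sup>2(c \<mu>)\<close>, and \<open>P\<close> is symmetric on \<open>L\<^sup>2(c \<mu>)\<close>, so \<open>\<langle>h, g - P g\<rangle> = \<langle>g, \<phi>\<rangle>\<close>
  (\<open>energy_inner_laplacian\<close>).  If this vanishes for all \<open>g\<close> in \<open>\<D>\<^sub>f\<^sub>i\<^sub>n\<close>, then \<open>\<phi>\<close>, which lies in the closure of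
  \<open>\<D>\<^sub>f\<^sub>i\<^sub>n\<close>, has energy zero.  By Cauchy--Schwarz \<open>0 = \<langle>h, \<phi>\<rangle> = \<integral> c \<phi>\<^sup>2 d\<mu>\<close>, and \<open>h\<close> is harmonic.
\<close>

section \<open>Square integrable functions\<close>

definition square_integrable :: "'b measure \<Rightarrow> ('b \<Rightarrow> real) \<Rightarrow> bool" where
  "square_integrable M F \<longleftrightarrow> F \<in> borel_measurable M \<and> integrable M (\<lambda>z. (F z)\<^sup>2)"

definition l2norm :: "'b measure \<Rightarrow> ('b \<Rightarrow> real) \<Rightarrow> real" where
  "l2norm M F = sqrt (\<integral>z. (F z)\<^sup>2 \<partial>M)"

lemma square_integrableD:
  assumes "square_integrable M F"
  shows "F \<in> borel_measurable M" "integrable M (\<lambda>z. (F z)\<^sup>2)"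
  using assms by (auto simp: square_integrable_def)

lemma square_integrable_iff_nn:
  "square_integrable M F \<longleftrightarrow>
     F \<in> borel_measurable M \<and> (\<integral>\<^sup>+ z. ennreal ((F z)\<^sup>2) \<partial>M) < \<infinity>"
  by (auto simp: square_integrable_def integrable_iff_bounded)

lemma l2norm_nonneg [simp]: "0 \<le> l2norm M F"
  by (simp add: l2norm_def)

lemma l2norm_sq: "(l2norm M F)\<^sup>2 = (\<integral>z. (F z)\<^sup>2 \<partial>M)"
  by (simp add: l2norm_def)

lemma integrable_mult_square_integrable:
  assumes "square_integrable M F" "square_integrable M G"
  shows "integrable M (\<lambda>z. F z * G z)"
proof (rule Bochner_Integration.integrable_bound)
  show "integrable M (\<lambda>z. (F z)\<^sup>2 + (G z)\<^sup>2)"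
    using assms by (intro Bochner_Integration.integrable_add) (auto dest: square_integrableD)
  show "(\<lambda>z. F z * G z) \<in> borel_measurable M"
    using assms[THEN square_integrableD(1)] by simp
  have "\<bar>a * b\<bar> \<le> a\<^sup>2 + b\<^sup>2" for a b :: real
  proof -
    have "2 * (\<bar>a\<bar> * \<bar>b\<bar>) \<le> a\<^sup>2 + b\<^sup>2"
      using sum_squares_bound[of "\<bar>a\<bar>" "\<bar>b\<bar>"] by simp
    moreover have "0 \<le> \<bar>a\<bar> * \<bar>b\<bar>" by simp
    ultimately show ?thesis unfolding abs_mult by linarith
  qed
  then show "AE z in M. norm (F z * G z) \<le> norm ((F z)\<^sup>2 + (G z)\<^sup>2)"
    by simp
qed

lemma square_integrable_lincomb:
  assumes "square_integrable M F" "square_integrable M G"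
  shows "square_integrable M (\<lambda>z. a * F z + b * G z)"
  unfolding square_integrable_def
proof
  have [measurable]: "F \<in> borel_measurable M" "G \<in> borel_measurable M"
    using assms by (auto dest: square_integrableD)
  show "(\<lambda>z. a * F z + b * G z) \<in> borel_measurable M" by measurable
  have "integrable M (\<lambda>z. a\<^sup>2 * (F z)\<^sup>2 + b\<^sup>2 * (G z)\<^sup>2 + 2 * a * b * (F z * G z))"
    by (intro Bochner_Integration.integrable_add integrable_mult_right
        integrable_mult_square_integrable assms assms[THEN square_integrableD(2)])
  then show "integrable M (\<lambda>z. (a * F z + b * G z)\<^sup>2)"
    by (rule Bochner_Integration.integrable_cong[THEN iffD1, rotated -1])
       (auto simp: power2_eq_square algebra_simps)
qed

lemma square_integrable_minus:
  "square_integrable M F \<Longrightarrow> square_integrable M (\<lambda>z. - F z)"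
  using square_integrable_lincomb[of M F F "-1" 0] by simp

lemma square_integrable_add:
  "square_integrable M F \<Longrightarrow> square_integrable M G \<Longrightarrow> square_integrable M (\<lambda>z. F z + G z)"
  using square_integrable_lincomb[of M F G 1 1] by simp

lemma square_integrable_diff:
  "square_integrable M F \<Longrightarrow> square_integrable M G \<Longrightarrow> square_integrable M (\<lambda>z. F z - G z)"
  using square_integrable_lincomb[of M F G 1 "-1"] by simp

lemma l2norm_Cauchy_Schwarz:
  assumes F: "square_integrable M F" and G: "square_integrable M G"
  shows "\<bar>\<integral>z. F z * G z \<partial>M\<bar> \<le> l2norm M F * l2norm M G"
proof -
  let ?a = "\<integral>z. (F z)\<^sup>2 \<partial>M" and ?b = "\<integral>z. F z * G z \<partial>M" and ?c = "\<integral>z. (G z)\<^sup>2 \<partial>M"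
  note int = square_integrableD(2)[OF F] square_integrableD(2)[OF G]
    integrable_mult_square_integrable[OF F G]
  have "0 \<le> s\<^sup>2 * ?a + 2 * s * t * ?b + t\<^sup>2 * ?c" for s t
  proof -
    have "0 \<le> (\<integral>z. (s * F z + t * G z)\<^sup>2 \<partial>M)" by (rule integral_nonneg_AE) auto
    also have "\<dots> = (\<integral>z. s\<^sup>2 * (F z)\<^sup>2 + 2 * s * t * (F z * G z) + t\<^sup>2 * (G z)\<^sup>2 \<partial>M)"
      by (rule Bochner_Integration.integral_cong) (auto simp: power2_eq_square algebra_simps)
    also have "\<dots> = s\<^sup>2 * ?a + 2 * s * t * ?b + t\<^sup>2 * ?c"
      using int by (subst Bochner_Integration.integral_add Bochner_Integration.integral_mult_right_zero;
          (intro Bochner_Integration.integrable_add)?; simp)+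
    finally show ?thesis .
  qed
  note pos = this
  have a: "0 \<le> ?a" and c: "0 \<le> ?c" by (auto intro: integral_nonneg_AE)
  have "?b\<^sup>2 \<le> ?a * ?c"
  proof (cases "?c = 0")
    case True
    have "?b = 0"
    proof (rule ccontr)
      assume "?b \<noteq> 0"
      have "0 \<le> ?a + 2 * (- (?a + 1) / (2 * ?b)) * ?b"
        using pos[of 1 "- (?a + 1) / (2 * ?b)"] True by simp
      also have "\<dots> = -1" using \<open>?b \<noteq> 0\<close> by (simp add: field_simps)
      finally show False by simp
    qed
    then show ?thesis using a c by simp
  next
    case False
    then have "0 < ?c" using c by (rule le_neq_trans[OF _ not_sym, rotated])
    have "0 \<le> ?c\<^sup>2 * ?a + 2 * ?c * (- ?b) * ?b + (- ?b)\<^sup>2 * ?c" by (rule pos)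
    also have "\<dots> = ?c * (?a * ?c - ?b\<^sup>2)" by (simp add: power2_eq_square algebra_simps)
    finally show ?thesis using \<open>0 < ?c\<close> by (simp add: zero_le_mult_iff)
  qed
  then have "sqrt (?b\<^sup>2) \<le> sqrt (?a * ?c)" by (rule real_sqrt_le_mono)
  then show ?thesis by (simp add: l2norm_def real_sqrt_mult)
qed

lemma l2norm_scale: "l2norm M (\<lambda>z. a * F z) = \<bar>a\<bar> * l2norm M F"
  by (simp add: l2norm_def power_mult_distrib real_sqrt_mult)

lemma l2norm_triangle:
  assumes F: "square_integrable M F" and G: "square_integrable M G"
  shows "l2norm M (\<lambda>z. F z + G z) \<le> l2norm M F + l2norm M G"
proof (rule power2_le_imp_le)
  note int = square_integrableD(2)[OF F] square_integrableD(2)[OF G]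
    integrable_mult_square_integrable[OF F G]
  have "(l2norm M (\<lambda>z. F z + G z))\<^sup>2 = (\<integral>z. (F z)\<^sup>2 + 2 * (F z * G z) + (G z)\<^sup>2 \<partial>M)"
    unfolding l2norm_sq
    by (rule Bochner_Integration.integral_cong) (auto simp: power2_eq_square algebra_simps)
  also have "\<dots> = (l2norm M F)\<^sup>2 + 2 * (\<integral>z. F z * G z \<partial>M) + (l2norm M G)\<^sup>2"
    using int by (simp add: l2norm_sq)
  also have "\<dots> \<le> (l2norm M F + l2norm M G)\<^sup>2"
    using l2norm_Cauchy_Schwarz[OF F G] by (simp add: power2_eq_square algebra_simps)
  finally show "(l2norm M (\<lambda>z. F z + G z))\<^sup>2 \<le> (l2norm M F + l2norm M G)\<^sup>2" .
qed simp

lemma square_integrable_bound: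
  assumes F: "square_integrable M F" and G: "G \<in> borel_measurable M"
    and le: "AE z in M. \<bar>G z\<bar> \<le> \<bar>F z\<bar>"
  shows "square_integrable M G" "l2norm M G \<le> l2norm M F"
proof -
  have *: "AE z in M. (G z)\<^sup>2 \<le> (F z)\<^sup>2"
    using le by eventually_elim (simp add: abs_le_square_iff)
  have int: "integrable M (\<lambda>z. (G z)\<^sup>2)"
    by (rule Bochner_Integration.integrable_bound[OF square_integrableD(2)[OF F]])
       (use G * in \<open>auto\<close>)
  then show "square_integrable M G" using G by (simp add: square_integrable_def)
  show "l2norm M G \<le> l2norm M F"
    unfolding l2norm_def
    by (intro real_sqrt_le_mono integral_mono_AE int square_integrableD(2)[OF F] *)
qed

lemma l2norm_nn:
  assumes "square_integrable M F"
  shows "ennreal ((l2norm M F)\<^sup>2) = (\<integral>\<^sup>+ z. ennreal ((F z)\<^sup>2) \<partial>M)"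
  unfolding l2norm_sq
  by (subst nn_integral_eq_integral[symmetric]) (auto intro: square_integrableD assms)

lemma square_integrable_nn_le:
  assumes F: "F \<in> borel_measurable M" and C: "0 \<le> C"
    and le: "(\<integral>\<^sup>+ z. ennreal ((F z)\<^sup>2) \<partial>M) \<le> ennreal (C\<^sup>2)"
  shows "square_integrable M F" "l2norm M F \<le> C"
proof -
  show s: "square_integrable M F"
    using F le_less_trans[OF le] by (simp add: square_integrable_iff_nn)
  have "ennreal ((l2norm M F)\<^sup>2) \<le> ennreal (C\<^sup>2)"
    using le by (simp add: l2norm_nn[OF s])
  then have "(l2norm M F)\<^sup>2 \<le> C\<^sup>2" by simp
  then show "l2norm M F \<le> C" using C by (rule power2_le_imp_le)
qed

text \<open>
  Fatou's lemma in two forms.  The bound on the lower limit is stated separately because it is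
  also needed where no limit exists, to exclude that \<open>(F n z)\<^sup>2\<close> tends to infinity.
\<close>

lemma liminf_square_bounded:
  assumes F: "\<And>n. square_integrable M (F n)" and C: "\<And>n. l2norm M (F n) \<le> C"
  shows "(\<integral>\<^sup>+ z. liminf (\<lambda>n. ennreal ((F n z)\<^sup>2)) \<partial>M) \<le> ennreal (C\<^sup>2)"
proof -
  have [measurable]: "F n \<in> borel_measurable M" for n using F by (rule square_integrableD)
  have "(\<integral>\<^sup>+ z. liminf (\<lambda>n. ennreal ((F n z)\<^sup>2)) \<partial>M)
      \<le> liminf (\<lambda>n. \<integral>\<^sup>+ z. ennreal ((F n z)\<^sup>2) \<partial>M)"
    by (rule nn_integral_liminf) measurable
  also have "\<dots> \<le> liminf (\<lambda>n. ennreal (C\<^sup>2))"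
    by (intro Liminf_mono always_eventually allI)
       (auto simp: l2norm_nn[OF F, symmetric] intro!: ennreal_leI power_mono C)
  finally show ?thesis by (simp add: Liminf_const)
qed

lemma l2norm_Fatou:
  assumes F: "\<And>n. square_integrable M (F n)" and C: "\<And>n. l2norm M (F n) \<le> C"
    and G: "G \<in> borel_measurable M" and lim: "AE z in M. (\<lambda>n. F n z) \<longlonglongrightarrow> G z"
  shows "square_integrable M G" "l2norm M G \<le> C"
proof -
  have "(\<integral>\<^sup>+ z. ennreal ((G z)\<^sup>2) \<partial>M) = (\<integral>\<^sup>+ z. liminf (\<lambda>n. ennreal ((F n z)\<^sup>2)) \<partial>M)"
    using lim
  proof (intro nn_integral_cong_AE, eventually_elim)
    fix z assume "(\<lambda>n. F n z) \<longlonglongrightarrow> G z"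
    then have "(\<lambda>n. ennreal ((F n z)\<^sup>2)) \<longlonglongrightarrow> ennreal ((G z)\<^sup>2)"
      by (intro tendsto_ennrealI tendsto_power)
    then show "ennreal ((G z)\<^sup>2) = liminf (\<lambda>n. ennreal ((F n z)\<^sup>2))"
      by (intro lim_imp_Liminf[symmetric]) auto
  qed
  also have "\<dots> \<le> ennreal (C\<^sup>2)" by (rule liminf_square_bounded[OF F C])
  finally have le: "(\<integral>\<^sup>+ z. ennreal ((G z)\<^sup>2) \<partial>M) \<le> ennreal (C\<^sup>2)" .
  have "0 \<le> C" using C[of 0] l2norm_nonneg[of M "F 0"] by linarith
  from square_integrable_nn_le[OF G this le]
  show "square_integrable M G" "l2norm M G \<le> C" .
qed

lemma l2norm_dominated:
  assumes G: "square_integrable M G" and F: "\<And>n. F n \<in> borel_measurable M"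
    and le: "\<And>n. AE z in M. \<bar>F n z\<bar> \<le> \<bar>G z\<bar>" and lim: "AE z in M. (\<lambda>n. F n z) \<longlonglongrightarrow> 0"
  shows "(\<lambda>n. l2norm M (F n)) \<longlonglongrightarrow> 0"
proof -
  have "(\<lambda>n. \<integral>z. (F n z)\<^sup>2 \<partial>M) \<longlonglongrightarrow> (\<integral>z. 0 \<partial>M)"
  proof (rule integral_dominated_convergence[where w="\<lambda>z. (G z)\<^sup>2"])
    show "AE z in M. (\<lambda>n. (F n z)\<^sup>2) \<longlonglongrightarrow> 0"
      using lim by eventually_elim (auto intro!: tendsto_eq_intros)
    show "AE z in M. norm ((F n z)\<^sup>2) \<le> (G z)\<^sup>2" for n
      using le[of n] by eventually_elim (simp add: abs_le_square_iff)
  qed (use F square_integrableD[OF G] in \<open>auto\<close>)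
  then have "(\<lambda>n. sqrt (\<integral>z. (F n z)\<^sup>2 \<partial>M)) \<longlonglongrightarrow> sqrt (\<integral>z. 0 \<partial>M)"
    by (rule tendsto_real_sqrt)
  then show ?thesis by (simp add: l2norm_def)
qed

lemma l2norm_eq_0D:
  assumes "square_integrable M F" "l2norm M F = 0"
  shows "AE z in M. F z = 0"
proof -
  have "(\<integral>z. (F z)\<^sup>2 \<partial>M) = 0" using assms(2) by (simp add: l2norm_def)
  then have "AE z in M. (F z)\<^sup>2 = 0"
    using integral_nonneg_eq_0_iff_AE[OF square_integrableD(2)[OF assms(1)]] by simp
  then show ?thesis by simp
qed

lemma (in prob_space) square_expectation_le:
  assumes "square_integrable M F"
  shows "(\<integral>x. F x \<partial>M)\<^sup>2 \<le> (\<integral>x. (F x)\<^sup>2 \<partial>M)"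
proof -
  have "square_integrable M (\<lambda>_. 1)" by (simp add: square_integrable_def)
  from l2norm_Cauchy_Schwarz[OF assms this]
  have "\<bar>\<integral>x. F x \<partial>M\<bar> \<le> l2norm M F" by (simp add: l2norm_def prob_space)
  then have "\<bar>\<integral>x. F x \<partial>M\<bar>\<^sup>2 \<le> (l2norm M F)\<^sup>2" by (intro power_mono) auto
  then show ?thesis by (simp add: l2norm_sq)
qed

section \<open>The normalised kernel\<close>

text \<open>
  Division by \<open>c x\<close> turns \<open>K\<close> into a kernel of probability measures, to which the measurability
  results for the Giry monad apply.  On the null set where \<open>c x\<close> is \<open>0\<close> or \<open>\<infinity>\<close>, the Dirac measure is an
  arbitrary choice that keeps every fibre a probability measure.
\<close>

definition transition :: "('a::topological_space \<Rightarrow> 'a measure) \<Rightarrow> 'a \<Rightarrow> 'a measure" where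
  "transition K x =
     (if 0 < emeasure (K x) UNIV \<and> emeasure (K x) UNIV < \<infinity>
      then scale_measure (inverse (emeasure (K x) UNIV)) (K x) else return borel x)"

text \<open>
  The conditional expectation of \<open>F\<close> given the first coordinate.
\<close>

definition fibre_average ::
    "('a::topological_space \<Rightarrow> 'a measure) \<Rightarrow> ('a \<times> 'a \<Rightarrow> real) \<Rightarrow> 'a \<Rightarrow> real" where
  "fibre_average K F x = (\<integral>y. F (x, y) \<partial>transition K x)"

lemma integral_scale_measure:
  fixes f :: "'b \<Rightarrow> real"
  assumes [measurable]: "f \<in> borel_measurable M" and r: "0 \<le> r"
  shows "(\<integral>x. f x \<partial>scale_measure (ennreal r) M) = r * (\<integral>x. f x \<partial>M)"
proof -
  have "scale_measure (ennreal r) M = density M (\<lambda>_. ennreal r)"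
    by (rule measure_eqI) (simp_all add: emeasure_density nn_integral_cmult_indicator)
  then show ?thesis using r by (simp add: integral_density)
qed

context symmetric_measure_setting
begin

lemma spaces [simp]: "space \<mu> = UNIV" "space \<rho> = UNIV" "space (K x) = UNIV"
  using sets_eq_imp_space_eq[OF sets_mu] sets_eq_imp_space_eq[OF sets_rho]
    sets_eq_imp_space_eq[OF sets_K[of x]] by (simp_all add: space_pair_measure)

declare sets_mu [measurable_cong] sets_rho [measurable_cong] sets_K [measurable_cong]

lemma measurable_total [measurable]: "(\<lambda>x. emeasure (K x) UNIV) \<in> borel_measurable borel"
  by (rule measurable_K) simp

lemma sets_transition [simp, measurable_cong]: "sets (transition K x) = sets borel"
  by (simp add: transition_def sets_K)

lemma space_transition [simp]: "space (transition K x) = UNIV"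
  using sets_eq_imp_space_eq[OF sets_transition[of x]] by simp

lemma emeasure_transition:
  assumes "A \<in> sets borel"
  shows "emeasure (transition K x) A =
    (if 0 < emeasure (K x) UNIV \<and> emeasure (K x) UNIV < \<infinity>
     then inverse (emeasure (K x) UNIV) * emeasure (K x) A else indicator A x)"
  using assms by (simp add: transition_def)

lemma prob_space_transition: "prob_space (transition K x)"
proof
  have "inverse c * c = 1" if "0 < c" "c < \<infinity>" for c :: ennreal
    using that by (simp add: mult.commute ennreal_divide_self flip: divide_ennreal_def)
  then show "emeasure (transition K x) (space (transition K x)) = 1"
    by (simp add: emeasure_transition)
qed

lemma measurable_transition [measurable]: "transition K \<in> borel \<rightarrow>\<^sub>M subprob_algebra borel"
proof (rule measurable_subprob_algebra)
  show "subprob_space (transition K x)" for x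
    by (rule prob_space_imp_subprob_space[OF prob_space_transition])
  fix A :: "'a set" assume A [measurable]: "A \<in> sets borel"
  note measurable_K[OF A, measurable]
  show "(\<lambda>x. emeasure (transition K x) A) \<in> borel_measurable borel"
    by (subst emeasure_transition[OF A]) measurable
qed simp

lemma measurable_fibre_average [measurable]:
  assumes [measurable]: "F \<in> borel_measurable (borel \<Otimes>\<^sub>M borel)"
  shows "fibre_average K F \<in> borel_measurable borel"
proof -
  have "(\<lambda>x. \<integral>z. F z \<partial>(distr (transition K x) (borel \<Otimes>\<^sub>M borel) (\<lambda>y. (x, y)))) \<in> borel_measurable borel"
    using measurable_distr2[of "\<lambda>x y. (x, y)" borel borel "borel \<Otimes>\<^sub>M borel" "transition K"]
    by (intro measurable_compose[OF _ integral_measurable_subprob_algebra]) (auto simp: split_beta')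
  also have "(\<lambda>x. \<integral>z. F z \<partial>(distr (transition K x) (borel \<Otimes>\<^sub>M borel) (\<lambda>y. (x, y)))) = fibre_average K F"
    by (simp add: fun_eq_iff fibre_average_def integral_distr)
  finally show ?thesis .
qed

text \<open>
  Where \<open>c x\<close> is \<open>0\<close> or \<open>\<infinity>\<close>, the real number \<open>measure (K x) UNIV\<close> is \<open>0\<close> and so is \<open>markov_op K g x\<close>.  Hence the
  Markov operator maps Borel functions to Borel functions although \<open>c\<close> is controlled only almost
  everywhere.
\<close>

lemma markov_op_eq:
  assumes [measurable]: "g \<in> borel_measurable borel"
  shows "markov_op K g x = indicator {x. 0 < emeasure (K x) UNIV \<and> emeasure (K x) UNIV < \<infinity>} x
    * fibre_average K (\<lambda>z. g (snd z)) x"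
proof (cases "0 < emeasure (K x) UNIV \<and> emeasure (K x) UNIV < \<infinity>")
  case True
  define c where "c = measure (K x) UNIV"
  have c: "emeasure (K x) UNIV = ennreal c"
    using True by (simp add: c_def Sigma_Algebra.measure_def)
  have "0 < c" using True c by simp
  then have "transition K x = scale_measure (ennreal (inverse c)) (K x)"
    using True c by (simp add: transition_def inverse_ennreal)
  then show ?thesis using True \<open>0 < c\<close>
    by (simp add: markov_op_def fibre_average_def integral_scale_measure c_def[symmetric]
        measurable_cong_sets[OF sets_K refl] field_simps)
next
  case False
  then have "measure (K x) UNIV = 0"
    by (auto simp: Sigma_Algebra.measure_def top.not_eq_extremum[symmetric])
  then show ?thesis using False by (simp add: markov_op_def)
qed

lemma measurable_markov_op [measurable]:
  assumes [measurable]: "g \<in> borel_measurable borel"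
  shows "markov_op K g \<in> borel_measurable borel"
  unfolding markov_op_eq[OF assms, THEN ext] by measurable

lemma AE_markov_op_eq:
  assumes "g \<in> borel_measurable borel"
  shows "AE x in \<mu>. markov_op K g x = fibre_average K (\<lambda>z. g (snd z)) x"
  using c_pos_finite by eventually_elim (simp add: markov_op_eq[OF assms])

lemma emeasure_rho_cylinder:
  assumes [measurable]: "A \<in> sets borel"
  shows "emeasure \<rho> (A \<times> UNIV) = (\<integral>\<^sup>+ x\<in>A. emeasure (K x) UNIV \<partial>\<mu>)"
proof -
  have "emeasure \<rho> (A \<times> UNIV) = (\<integral>\<^sup>+ z. indicator (A \<times> UNIV) z \<partial>\<rho>)" by simp
  also have "\<dots> = (\<integral>\<^sup>+ x. (\<integral>\<^sup>+ y. indicator (A \<times> UNIV) (x, y) \<partial>K x) \<partial>\<mu>)"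
    by (rule disintegration) measurable
  also have "\<dots> = (\<integral>\<^sup>+ x\<in>A. emeasure (K x) UNIV \<partial>\<mu>)"
    by (intro nn_integral_cong) (auto split: split_indicator)
  finally show ?thesis .
qed

lemma exhausting_sets:
  obtains A :: "nat \<Rightarrow> 'a set"
  where "\<And>i. A i \<in> sets borel" "(\<Union>i. A i) = UNIV" "incseq A"
    "\<And>i. emeasure \<mu> (A i) < \<infinity>" "\<And>i. emeasure \<rho> (A i \<times> UNIV) < \<infinity>"
proof -
  obtain A where A: "range A \<subseteq> sets \<mu>" "(\<Union>i. A i) = space \<mu>" "\<And>i. emeasure \<mu> (A i) \<noteq> \<infinity>" "incseq A"
    by (rule sigma_finite_measure.sigma_finite_incseq[OF sigma_finite_mu]) blast
  show ?thesis
  proof (rule that[of A])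
    show A': "A i \<in> sets borel" for i using A(1) sets_mu by auto
    show f: "emeasure \<mu> (A i) < \<infinity>" for i using A(3)[of i] by (simp add: top.not_eq_extremum)
    show "emeasure \<rho> (A i \<times> UNIV) < \<infinity>" for i
      unfolding emeasure_rho_cylinder[OF A'] by (rule c_locally_integrable[OF A' f])
  qed (use A in simp_all)
qed

text \<open>
  Symmetry is given on rectangles only.  It extends to all measurable sets because rectangles form a
  generator closed under intersections and \<open>UNIV\<close> is a countable union of cylinders of finite measure.
\<close>

lemma distr_swap: "distr \<rho> (borel \<Otimes>\<^sub>M borel) prod.swap = \<rho>"
proof -
  obtain A :: "nat \<Rightarrow> 'a set" where A: "\<And>i. A i \<in> sets borel" "(\<Union>i. A i) = UNIV"
    "\<And>i. emeasure \<rho> (A i \<times> UNIV) < \<infinity>"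
    using exhausting_sets by metis
  let ?E = "{a \<times> b | a b. a \<in> sets (borel :: 'a measure) \<and> b \<in> sets (borel :: 'a measure)}"
  have sets: "sets (borel \<Otimes>\<^sub>M borel) = sigma_sets (UNIV :: ('a \<times> 'a) set) ?E"
    by (simp add: sets_pair_measure)
  have [measurable]: "prod.swap \<in> borel \<Otimes>\<^sub>M borel \<rightarrow>\<^sub>M (borel :: 'a measure) \<Otimes>\<^sub>M borel"
    unfolding prod.swap_def by measurable
  have "\<rho> = distr \<rho> (borel \<Otimes>\<^sub>M borel) prod.swap"
  proof (rule measure_eqI_generator_eq)
    show "Int_stable ?E" by (rule Int_stable_pair_measure_generator)
    show "?E \<subseteq> Pow UNIV" by simp
    show "sets \<rho> = sigma_sets UNIV ?E" "sets (distr \<rho> (borel \<Otimes>\<^sub>M borel) prod.swap) = sigma_sets UNIV ?E"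
      using sets_rho sets by simp_all
    show "range (\<lambda>i. A i \<times> UNIV) \<subseteq> ?E"
    proof (rule image_subsetI)
      fix i
      have "(UNIV :: 'a set) \<in> sets borel" by simp
      then show "A i \<times> UNIV \<in> ?E" using A(1) by blast
    qed
    show "(\<Union>i. A i \<times> UNIV) = (UNIV :: ('a \<times> 'a) set)" using A(2) by auto
    show "emeasure \<rho> (A i \<times> UNIV) \<noteq> \<infinity>" for i using A(3)[of i] by simp
    fix X assume "X \<in> ?E"
    then obtain a b where X: "X = a \<times> b" and ab [measurable]: "a \<in> sets borel" "b \<in> sets borel" by auto
    have "emeasure (distr \<rho> (borel \<Otimes>\<^sub>M borel) prod.swap) X = emeasure \<rho> (prod.swap -` X \<inter> space \<rho>)"
      unfolding X by (rule emeasure_distr) measurable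
    also have "prod.swap -` X \<inter> space \<rho> = b \<times> a" by (auto simp: X)
    finally show "emeasure \<rho> X = emeasure (distr \<rho> (borel \<Otimes>\<^sub>M borel) prod.swap) X"
      using symmetric_rho[OF ab] by (simp add: X)
  qed
  then show ?thesis by simp
qed

lemma measurable_swap [measurable]: "prod.swap \<in> borel \<Otimes>\<^sub>M borel \<rightarrow>\<^sub>M (borel :: 'a measure) \<Otimes>\<^sub>M borel"
  unfolding prod.swap_def by measurable

lemma integral_swap:
  fixes F :: "'a \<times> 'a \<Rightarrow> real"
  assumes [measurable]: "F \<in> borel_measurable (borel \<Otimes>\<^sub>M borel)"
  shows "(\<integral>z. F (snd z, fst z) \<partial>\<rho>) = (\<integral>z. F z \<partial>\<rho>)"
  using integral_distr[of prod.swap \<rho> "borel \<Otimes>\<^sub>M borel" F] distr_swap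
  by (simp add: prod.swap_def)

lemma integrable_swap:
  fixes F :: "'a \<times> 'a \<Rightarrow> real"
  assumes "integrable \<rho> F"
  shows "integrable \<rho> (\<lambda>z. F (snd z, fst z))"
proof -
  have [measurable]: "F \<in> borel_measurable (borel \<Otimes>\<^sub>M borel)"
    using borel_measurable_integrable[OF assms] by simp
  show ?thesis
    using integrable_distr_eq[of prod.swap \<rho> "borel \<Otimes>\<^sub>M borel" F] distr_swap assms
    by (simp add: prod.swap_def)
qed

text \<open>
  The first marginal of \<open>\<rho>\<close> is \<open>c \<mu>\<close>, which vanishes on the null sets of \<open>\<mu>\<close>.
\<close>

lemma AE_fst:
  assumes "AE x in \<mu>. P x"
  shows "AE z in \<rho>. P (fst z)"
proof -
  obtain N where N: "{x. \<not> P x} \<subseteq> N" "emeasure \<mu> N = 0" "N \<in> sets borel"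
    using AE_E[OF assms] sets_mu by auto
  show ?thesis
  proof (rule AE_I)
    show "{z \<in> space \<rho>. \<not> P (fst z)} \<subseteq> N \<times> UNIV" using N(1) by auto
    show "N \<times> UNIV \<in> sets \<rho>" using N(3) sets_rho by simp
    have "AE x in \<mu>. x \<notin> N" using N sets_mu by (intro AE_not_in) auto
    then have "(\<integral>\<^sup>+ x\<in>N. emeasure (K x) UNIV \<partial>\<mu>) = (\<integral>\<^sup>+ x. 0 \<partial>\<mu>)"
      by (intro nn_integral_cong_AE) (auto elim: eventually_mono)
    then show "emeasure \<rho> (N \<times> UNIV) = 0" by (simp add: emeasure_rho_cylinder[OF N(3)])
  qed
qed

text \<open>
  The converse of \<open>AE_fst\<close> rests on \<open>c\<close> being positive almost everywhere.
\<close>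

lemma AE_fstD:
  assumes P [measurable]: "Measurable.pred borel P" and ae: "AE z in \<rho>. P (fst z)"
  shows "AE x in \<mu>. P x"
proof -
  have "{x. \<not> P x} \<times> UNIV = {z \<in> space \<rho>. \<not> P (fst z)}" by auto
  then have "emeasure \<rho> ({x. \<not> P x} \<times> UNIV) = 0"
    using ae by (subst (asm) AE_iff_measurable[OF _ refl]) measurable
  then have "(\<integral>\<^sup>+ x\<in>{x. \<not> P x}. emeasure (K x) UNIV \<partial>\<mu>) = 0"
    by (subst (asm) emeasure_rho_cylinder) simp_all
  then have "AE x in \<mu>. emeasure (K x) UNIV * indicator {x. \<not> P x} x = 0"
    by (subst (asm) nn_integral_0_iff_AE) auto
  then show ?thesis using c_pos_finite
    by eventually_elim (auto split: split_indicator_asm)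
qed

text \<open>
  Integrating out the second coordinate against the normalised kernel does not change a
  \<open>\<rho>\<close>-integral: the inner integral does not depend on the second coordinate, so the disintegration
  multiplies it by \<open>c x\<close>, which cancels the normalisation.
\<close>

lemma nn_integral_fibrewise:
  fixes f :: "'a \<times> 'a \<Rightarrow> ennreal"
  assumes [measurable]: "f \<in> borel_measurable (borel \<Otimes>\<^sub>M borel)"
  shows "(\<integral>\<^sup>+ z. f z \<partial>\<rho>) = (\<integral>\<^sup>+ z. (\<integral>\<^sup>+ y. f (fst z, y) \<partial>transition K (fst z)) \<partial>\<rho>)"
proof -
  have [measurable]: "(\<lambda>x. \<integral>\<^sup>+ y. f (x, y) \<partial>transition K x) \<in> borel_measurable borel"
    by (rule nn_integral_measurable_subprob_algebra2[where N=borel]) simp_all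
  have "(\<integral>\<^sup>+ z. (\<integral>\<^sup>+ y. f (fst z, y) \<partial>transition K (fst z)) \<partial>\<rho>)
      = (\<integral>\<^sup>+ x. (\<integral>\<^sup>+ w. (\<integral>\<^sup>+ y. f (x, y) \<partial>transition K x) \<partial>K x) \<partial>\<mu>)"
    by (subst disintegration) simp_all
  also have "\<dots> = (\<integral>\<^sup>+ x. (\<integral>\<^sup>+ y. f (x, y) \<partial>K x) \<partial>\<mu>)"
    using c_pos_finite
  proof (intro nn_integral_cong_AE, eventually_elim)
    fix x assume x: "0 < emeasure (K x) UNIV \<and> emeasure (K x) UNIV < \<infinity>"
    let ?c = "emeasure (K x) UNIV"
    have "(\<integral>\<^sup>+ y. f (x, y) \<partial>transition K x) = inverse ?c * (\<integral>\<^sup>+ y. f (x, y) \<partial>K x)"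
      using x by (simp add: transition_def nn_integral_scale_measure)
    moreover have "inverse ?c * ?c = 1"
      using x by (simp add: mult.commute ennreal_divide_self zero_less_iff_neq_zero flip: divide_ennreal_def)
    ultimately show "(\<integral>\<^sup>+ w. (\<integral>\<^sup>+ y. f (x, y) \<partial>transition K x) \<partial>K x) = (\<integral>\<^sup>+ y. f (x, y) \<partial>K x)"
      by (simp add: mult.assoc[symmetric] mult.commute[of _ ?c] mult.commute[of "inverse ?c" ?c])
  qed
  also have "\<dots> = (\<integral>\<^sup>+ z. f z \<partial>\<rho>)" by (rule disintegration[symmetric]) simp
  finally show ?thesis by simp
qed

lemma AE_integrable_fibre:
  fixes F :: "'a \<times> 'a \<Rightarrow> real"
  assumes "integrable \<rho> F"
  shows "AE z in \<rho>. integrable (transition K (fst z)) (\<lambda>y. F (fst z, y))"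
proof -
  have [measurable]: "F \<in> borel_measurable (borel \<Otimes>\<^sub>M borel)"
    using borel_measurable_integrable[OF assms] by simp
  have "(\<integral>\<^sup>+ z. (\<integral>\<^sup>+ y. ennreal (norm (F (fst z, y))) \<partial>transition K (fst z)) \<partial>\<rho>) \<noteq> \<infinity>"
    using integrable_iff_bounded[THEN iffD1, OF assms]
    by (subst nn_integral_fibrewise[of "\<lambda>z. ennreal (norm (F z))", symmetric]) simp_all
  moreover have "(\<lambda>z. \<integral>\<^sup>+ y. ennreal (norm (F (fst z, y))) \<partial>transition K (fst z)) \<in> borel_measurable \<rho>"
    by (rule measurable_compose[OF _ nn_integral_measurable_subprob_algebra2[where M=borel and N=borel]])
       simp_all
  ultimately have "AE z in \<rho>. (\<integral>\<^sup>+ y. ennreal (norm (F (fst z, y))) \<partial>transition K (fst z)) \<noteq> \<infinity>"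
    by (rule nn_integral_noteq_infinite[rotated])
  then show ?thesis
    by eventually_elim (auto intro!: integrableI_bounded simp: top.not_eq_extremum)
qed

lemma fibre_average_nonneg_integral:
  assumes F: "integrable \<rho> F" and pos: "\<And>z. 0 \<le> F z"
  shows "integrable \<rho> (\<lambda>z. fibre_average K F (fst z))"
    and "(\<integral>z. fibre_average K F (fst z) \<partial>\<rho>) = (\<integral>z. F z \<partial>\<rho>)"
proof -
  have [measurable]: "F \<in> borel_measurable (borel \<Otimes>\<^sub>M borel)"
    using borel_measurable_integrable[OF F] by simp
  have "AE z in \<rho>. ennreal (fibre_average K F (fst z)) = (\<integral>\<^sup>+ y. F (fst z, y) \<partial>transition K (fst z))"
    using AE_integrable_fibre[OF F]
    by eventually_elim (simp add: fibre_average_def nn_integral_eq_integral pos)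
  then have "(\<integral>\<^sup>+ z. ennreal (fibre_average K F (fst z)) \<partial>\<rho>) = (\<integral>\<^sup>+ z. F z \<partial>\<rho>)"
    by (subst nn_integral_fibrewise, simp) (rule nn_integral_cong_AE)
  moreover have "0 \<le> fibre_average K F x" for x
    by (simp add: fibre_average_def pos)
  ultimately show "integrable \<rho> (\<lambda>z. fibre_average K F (fst z))"
    and "(\<integral>z. fibre_average K F (fst z) \<partial>\<rho>) = (\<integral>z. F z \<partial>\<rho>)"
    using F pos by (auto simp: integrable_iff_bounded integral_eq_nn_integral)
qed

lemma fibre_average_integral:
  assumes F: "integrable \<rho> F"
  shows "integrable \<rho> (\<lambda>z. fibre_average K F (fst z))"
    and "(\<integral>z. fibre_average K F (fst z) \<partial>\<rho>) = (\<integral>z. F z \<partial>\<rho>)"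
proof -
  let ?p = "\<lambda>z. max 0 (F z)" and ?n = "\<lambda>z. max 0 (- F z)"
  have [measurable]: "F \<in> borel_measurable (borel \<Otimes>\<^sub>M borel)"
    using borel_measurable_integrable[OF F] by simp
  have p: "integrable \<rho> ?p" and n: "integrable \<rho> ?n" using F by simp_all
  note P = fibre_average_nonneg_integral[OF p, simplified]
    and N = fibre_average_nonneg_integral[OF n, simplified]
  have F_eq: "F z = ?p z - ?n z" for z by auto
  have ae: "AE z in \<rho>. fibre_average K F (fst z) = fibre_average K ?p (fst z) - fibre_average K ?n (fst z)"
    using AE_integrable_fibre[OF p] AE_integrable_fibre[OF n]
    by eventually_elim
       (unfold fibre_average_def, subst F_eq, rule Bochner_Integration.integral_diff)
  have int: "integrable \<rho> (\<lambda>z. fibre_average K ?p (fst z) - fibre_average K ?n (fst z))"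
    using P N by simp
  show "integrable \<rho> (\<lambda>z. fibre_average K F (fst z))"
    by (rule integrable_cong_AE[THEN iffD2, OF _ _ ae int]) measurable
  have "(\<integral>z. fibre_average K F (fst z) \<partial>\<rho>)
      = (\<integral>z. fibre_average K ?p (fst z) - fibre_average K ?n (fst z) \<partial>\<rho>)"
    by (rule integral_cong_AE[OF _ _ ae]) measurable
  also have "\<dots> = (\<integral>z. ?p z - ?n z \<partial>\<rho>)" using P N p n by simp
  finally show "(\<integral>z. fibre_average K F (fst z) \<partial>\<rho>) = (\<integral>z. F z \<partial>\<rho>)"
    by (simp flip: F_eq)
qed

text \<open>
  Jensen's inequality on each fibre.
\<close>

lemma fibre_average_square_integrable:
  assumes F: "square_integrable \<rho> F"
  shows "square_integrable \<rho> (\<lambda>z. fibre_average K F (fst z))"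
proof -
  have [measurable]: "F \<in> borel_measurable (borel \<Otimes>\<^sub>M borel)"
    using square_integrableD(1)[OF F] by simp
  note F2 = square_integrableD(2)[OF F]
  have "AE z in \<rho>. (fibre_average K F (fst z))\<^sup>2 \<le> fibre_average K (\<lambda>z. (F z)\<^sup>2) (fst z)"
    using AE_integrable_fibre[OF F2]
  proof eventually_elim
    fix z assume "integrable (transition K (fst z)) (\<lambda>y. (F (fst z, y))\<^sup>2)"
    then have "square_integrable (transition K (fst z)) (\<lambda>y. F (fst z, y))"
      by (simp add: square_integrable_def)
    then show "(fibre_average K F (fst z))\<^sup>2 \<le> fibre_average K (\<lambda>z. (F z)\<^sup>2) (fst z)"
      unfolding fibre_average_def
      by (rule prob_space.square_expectation_le[OF prob_space_transition])
  qed
  then have "AE z in \<rho>. norm ((fibre_average K F (fst z))\<^sup>2) \<le> norm (fibre_average K (\<lambda>z. (F z)\<^sup>2) (fst z))"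
    by eventually_elim simp
  then have "integrable \<rho> (\<lambda>z. (fibre_average K F (fst z))\<^sup>2)"
    by (rule Bochner_Integration.integrable_bound[OF fibre_average_integral(1)[OF F2], rotated]) measurable
  then show ?thesis by (simp add: square_integrable_def)
qed

text \<open>
  The projection property of the conditional expectation: a factor that depends only on the first
  coordinate can be pulled out of the fibre integral.
\<close>

lemma integral_mult_fibre_average:
  assumes F: "square_integrable \<rho> F" and u: "square_integrable \<rho> (\<lambda>z. u (fst z))"
  shows "(\<integral>z. F z * u (fst z) \<partial>\<rho>) = (\<integral>z. fibre_average K F (fst z) * u (fst z) \<partial>\<rho>)"
proof -
  have "(\<integral>z. F z * u (fst z) \<partial>\<rho>) = (\<integral>z. fibre_average K (\<lambda>z. F z * u (fst z)) (fst z) \<partial>\<rho>)"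
    by (rule fibre_average_integral(2)[symmetric, OF integrable_mult_square_integrable[OF F u]])
  then show ?thesis by (simp add: fibre_average_def)
qed

end

section \<open>The energy form\<close>

definition grad :: "('a \<Rightarrow> real) \<Rightarrow> 'a \<times> 'a \<Rightarrow> real" where
  "grad f z = f (fst z) - f (snd z)"

text \<open>
  The space \<open>L\<^sup>2(c \<mu>)\<close>, written with the first marginal of \<open>\<rho>\<close>.  It has the same closure in energy as
  \<open>D_fin \<mu>\<close>, and unlike \<open>D_fin \<mu>\<close> it is stable under \<open>markov_op K\<close> and under taking smaller functions.
\<close>

definition vertex_L2 :: "('a::topological_space \<times> 'a) measure \<Rightarrow> ('a \<Rightarrow> real) set" where
  "vertex_L2 \<rho> = {g \<in> borel_measurable borel. square_integrable \<rho> (\<lambda>z. g (fst z))}"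

lemma energy_inner_grad: "energy_inner \<rho> f g = (\<integral>z. grad f z * grad g z \<partial>\<rho>) / 2"
  by (simp add: energy_inner_def grad_def)

lemma energy_norm_grad: "energy_norm \<rho> f = l2norm \<rho> (grad f) / sqrt 2"
  by (simp add: energy_norm_def energy_inner_grad l2norm_def power2_eq_square real_sqrt_divide)

lemma energy_norm_nonneg [simp]: "0 \<le> energy_norm \<rho> f"
  by (simp add: energy_norm_grad)

lemma energy_norm_sq: "(energy_norm \<rho> f)\<^sup>2 = energy_inner \<rho> f f"
  by (simp add: energy_norm_grad energy_inner_grad power_divide l2norm_sq power2_eq_square[of "grad f _"])

lemma energy_inner_commute: "energy_inner \<rho> f g = energy_inner \<rho> g f"
  by (simp add: energy_inner_grad mult.commute)

lemma grad_scale: "grad (\<lambda>x. c * f x) = (\<lambda>z. c * grad f z)"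
  by (simp add: grad_def fun_eq_iff algebra_simps)

lemma grad_add: "grad (\<lambda>x. f x + g x) = (\<lambda>z. grad f z + grad g z)"
  by (simp add: grad_def fun_eq_iff)

lemma grad_diff: "grad (\<lambda>x. f x - g x) = (\<lambda>z. grad f z - grad g z)"
  by (simp add: grad_def fun_eq_iff)

lemma energy_closure_finite_energy: "f \<in> energy_closure \<rho> D \<Longrightarrow> f \<in> finite_energy \<rho>"
  by (simp add: energy_closure_def)

lemma energy_closureE:
  assumes "f \<in> energy_closure \<rho> D" "0 < \<epsilon>"
  obtains g where "g \<in> D" "energy_norm \<rho> (\<lambda>x. f x - g x) < \<epsilon>"
  using assms unfolding energy_closure_def by blast

lemma energy_norm_scale: "energy_norm \<rho> (\<lambda>x. c * f x) = \<bar>c\<bar> * energy_norm \<rho> f"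
  by (simp add: energy_norm_grad grad_scale l2norm_scale)

lemma energy_inner_scale_left: "energy_inner \<rho> (\<lambda>x. c * f x) g = c * energy_inner \<rho> f g"
  by (simp add: energy_inner_grad grad_scale mult.assoc)

context symmetric_measure_setting
begin

lemma measurable_grad [measurable]:
  assumes [measurable]: "f \<in> borel_measurable borel"
  shows "grad f \<in> borel_measurable (borel \<Otimes>\<^sub>M borel)"
  unfolding grad_def by measurable

lemma finite_energy_iff:
  "f \<in> finite_energy \<rho> \<longleftrightarrow> f \<in> borel_measurable borel \<and> square_integrable \<rho> (grad f)"
proof -
  have "grad f \<in> borel_measurable \<rho>" if "f \<in> borel_measurable borel"
    using measurable_grad[OF that] by simp
  then show ?thesis by (auto simp: finite_energy_def square_integrable_iff_nn grad_def)
qed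

lemma finite_energyD:
  assumes "f \<in> finite_energy \<rho>"
  shows "f \<in> borel_measurable borel" "square_integrable \<rho> (grad f)"
  using assms by (simp_all add: finite_energy_iff)

lemma finite_energy_add:
  "f \<in> finite_energy \<rho> \<Longrightarrow> g \<in> finite_energy \<rho> \<Longrightarrow> (\<lambda>x. f x + g x) \<in> finite_energy \<rho>"
  by (simp add: finite_energy_iff grad_add square_integrable_add borel_measurable_add)

lemma finite_energy_diff:
  "f \<in> finite_energy \<rho> \<Longrightarrow> g \<in> finite_energy \<rho> \<Longrightarrow> (\<lambda>x. f x - g x) \<in> finite_energy \<rho>"
  by (simp add: finite_energy_iff grad_diff square_integrable_diff borel_measurable_diff)

lemma finite_energy_scale:
  "f \<in> finite_energy \<rho> \<Longrightarrow> (\<lambda>x. c * f x) \<in> finite_energy \<rho>"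
  using square_integrable_lincomb[of \<rho> "grad f" "grad f" c 0]
  by (simp add: finite_energy_iff grad_scale borel_measurable_times)

lemma energy_inner_add_left:
  assumes "f \<in> finite_energy \<rho>" "g \<in> finite_energy \<rho>" "h \<in> finite_energy \<rho>"
  shows "energy_inner \<rho> (\<lambda>x. f x + g x) h = energy_inner \<rho> f h + energy_inner \<rho> g h"
  using assms[THEN finite_energyD(2)]
  by (simp add: energy_inner_grad grad_add distrib_right integrable_mult_square_integrable
      Bochner_Integration.integral_add add_divide_distrib)

lemma energy_inner_diff_left:
  assumes "f \<in> finite_energy \<rho>" "g \<in> finite_energy \<rho>" "h \<in> finite_energy \<rho>"
  shows "energy_inner \<rho> (\<lambda>x. f x - g x) h = energy_inner \<rho> f h - energy_inner \<rho> g h"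
  using assms[THEN finite_energyD(2)]
  by (simp add: energy_inner_grad grad_diff left_diff_distrib integrable_mult_square_integrable
      Bochner_Integration.integral_diff diff_divide_distrib)

lemma energy_Cauchy_Schwarz:
  assumes "f \<in> finite_energy \<rho>" "g \<in> finite_energy \<rho>"
  shows "\<bar>energy_inner \<rho> f g\<bar> \<le> energy_norm \<rho> f * energy_norm \<rho> g"
  using l2norm_Cauchy_Schwarz[OF assms[THEN finite_energyD(2)]]
  by (simp add: energy_inner_grad energy_norm_grad)

lemma energy_norm_triangle:
  assumes "f \<in> finite_energy \<rho>" "g \<in> finite_energy \<rho>"
  shows "energy_norm \<rho> (\<lambda>x. f x + g x) \<le> energy_norm \<rho> f + energy_norm \<rho> g"
  using l2norm_triangle[OF assms[THEN finite_energyD(2)]]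
  by (simp add: energy_norm_grad grad_add add_divide_distrib[symmetric] divide_right_mono)

lemma energy_norm_triangle_diff:
  assumes "f \<in> finite_energy \<rho>" "g \<in> finite_energy \<rho>" "h \<in> finite_energy \<rho>"
  shows "energy_norm \<rho> (\<lambda>x. f x - h x) \<le> energy_norm \<rho> (\<lambda>x. f x - g x) + energy_norm \<rho> (\<lambda>x. g x - h x)"
  using energy_norm_triangle[OF finite_energy_diff[OF assms(1,2)] finite_energy_diff[OF assms(2,3)]]
  by simp

text \<open>
  The Markovian property of the energy form; truncations, absolute values and restrictions to
  invariant sets are all handled by it.
\<close>

lemma finite_energy_contraction:
  assumes f: "f \<in> finite_energy \<rho>" and g: "g \<in> borel_measurable borel"
    and le: "AE z in \<rho>. \<bar>grad g z\<bar> \<le> \<bar>grad f z\<bar>"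
  shows "g \<in> finite_energy \<rho>" "energy_norm \<rho> g \<le> energy_norm \<rho> f"
proof -
  have "grad g \<in> borel_measurable \<rho>" using measurable_grad[OF g] by simp
  note * = square_integrable_bound[OF finite_energyD(2)[OF f] this le]
  show "g \<in> finite_energy \<rho>" using g * by (simp add: finite_energy_iff)
  show "energy_norm \<rho> g \<le> energy_norm \<rho> f" using * by (simp add: energy_norm_grad divide_right_mono)
qed

lemma finite_energy_Fatou:
  assumes f: "\<And>n. f n \<in> finite_energy \<rho>" and C: "\<And>n. energy_norm \<rho> (f n) \<le> C"
    and g: "g \<in> borel_measurable borel" and lim: "\<And>x. (\<lambda>n. f n x) \<longlonglongrightarrow> g x"
  shows "g \<in> finite_energy \<rho>" "energy_norm \<rho> g \<le> C"
proof -
  have meas: "grad g \<in> borel_measurable \<rho>" using measurable_grad[OF g] by simp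
  have bound: "l2norm \<rho> (grad (f n)) \<le> C * sqrt 2" for n
    using C[of n] by (simp add: energy_norm_grad field_simps)
  have conv: "AE z in \<rho>. (\<lambda>n. grad (f n) z) \<longlonglongrightarrow> grad g z"
    unfolding grad_def by (intro AE_I2 tendsto_diff lim)
  note l2norm_Fatou[OF finite_energyD(2)[OF f] bound meas conv]
  then show "g \<in> finite_energy \<rho>" "energy_norm \<rho> g \<le> C"
    using g by (simp_all add: finite_energy_iff energy_norm_grad field_simps)
qed

text \<open>
  Convergence in energy is obtained without estimates from pointwise convergence, as soon as the
  gradients are dominated by the gradient of a single finite energy function.
\<close>

lemma energy_norm_dominated:
  assumes f: "f \<in> finite_energy \<rho>" and g: "\<And>n. g n \<in> borel_measurable borel"
    and le: "\<And>n. AE z in \<rho>. \<bar>grad (g n) z\<bar> \<le> \<bar>grad f z\<bar>"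
    and lim: "\<And>x. (\<lambda>n. g n x) \<longlonglongrightarrow> 0"
  shows "(\<lambda>n. energy_norm \<rho> (g n)) \<longlonglongrightarrow> 0"
proof -
  have "(\<lambda>n. l2norm \<rho> (grad (g n))) \<longlonglongrightarrow> 0"
  proof (rule l2norm_dominated[OF finite_energyD(2)[OF f] _ le])
    show "grad (g n) \<in> borel_measurable \<rho>" for n using measurable_grad[OF g] by simp
    show "AE z in \<rho>. (\<lambda>n. grad (g n) z) \<longlonglongrightarrow> 0"
      unfolding grad_def using tendsto_diff[OF lim lim] by simp
  qed
  from tendsto_divide[OF this tendsto_const[of "sqrt 2"]] show ?thesis
    by (simp add: energy_norm_grad)
qed

lemma vertex_L2D:
  assumes "g \<in> vertex_L2 \<rho>"
  shows "g \<in> borel_measurable borel" "square_integrable \<rho> (\<lambda>z. g (fst z))"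
  using assms by (simp_all add: vertex_L2_def)

lemma vertex_L2_snd:
  assumes "g \<in> vertex_L2 \<rho>"
  shows "square_integrable \<rho> (\<lambda>z. g (snd z))" "l2norm \<rho> (\<lambda>z. g (snd z)) = l2norm \<rho> (\<lambda>z. g (fst z))"
proof -
  have [measurable]: "g \<in> borel_measurable borel" using assms by (rule vertex_L2D)
  have "integrable \<rho> (\<lambda>z. (g (fst z))\<^sup>2)"
    using vertex_L2D(2)[OF assms] by (rule square_integrableD)
  from integrable_swap[OF this] show "square_integrable \<rho> (\<lambda>z. g (snd z))"
    by (simp add: square_integrable_def)
  show "l2norm \<rho> (\<lambda>z. g (snd z)) = l2norm \<rho> (\<lambda>z. g (fst z))"
    unfolding l2norm_def using integral_swap[of "\<lambda>z. (g (fst z))\<^sup>2"] by simp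
qed

lemma vertex_L2_finite_energy:
  assumes "g \<in> vertex_L2 \<rho>"
  shows "g \<in> finite_energy \<rho>" "energy_norm \<rho> g \<le> 2 * l2norm \<rho> (\<lambda>z. g (fst z))"
proof -
  note g = vertex_L2D[OF assms] vertex_L2_snd[OF assms]
  have grad: "grad g = (\<lambda>z. g (fst z) + - g (snd z))" by (simp add: grad_def fun_eq_iff)
  show "g \<in> finite_energy \<rho>"
    unfolding finite_energy_iff grad
    using g by (intro conjI square_integrable_add square_integrable_minus)
  have "l2norm \<rho> (grad g) \<le> l2norm \<rho> (\<lambda>z. g (fst z)) + l2norm \<rho> (\<lambda>z. - g (snd z))"
    unfolding grad by (intro l2norm_triangle square_integrable_minus g)
  also have "\<dots> = 2 * l2norm \<rho> (\<lambda>z. g (fst z))"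
    using g(4) by (simp add: l2norm_def)
  finally have "l2norm \<rho> (grad g) \<le> 2 * l2norm \<rho> (\<lambda>z. g (fst z))" .
  moreover have "energy_norm \<rho> g \<le> l2norm \<rho> (grad g)"
    unfolding energy_norm_grad
    using l2norm_nonneg[of \<rho> "grad g"] by (simp add: divide_le_eq mult_le_cancel_left1 not_less)
  ultimately show "energy_norm \<rho> g \<le> 2 * l2norm \<rho> (\<lambda>z. g (fst z))" by linarith
qed

lemma vertex_L2_bound:
  assumes g: "g \<in> vertex_L2 \<rho>" and h [measurable]: "h \<in> borel_measurable borel"
    and le: "\<And>x. \<bar>h x\<bar> \<le> \<bar>g x\<bar>"
  shows "h \<in> vertex_L2 \<rho>"
  unfolding vertex_L2_def
  using square_integrable_bound(1)[OF vertex_L2D(2)[OF g], of "\<lambda>z. h (fst z)"] le by simp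

lemma vertex_L2_lincomb:
  assumes "g \<in> vertex_L2 \<rho>" "h \<in> vertex_L2 \<rho>"
  shows "(\<lambda>x. a * g x + b * h x) \<in> vertex_L2 \<rho>"
  using assms by (simp add: vertex_L2_def square_integrable_lincomb borel_measurable_add borel_measurable_times)

lemma vertex_L2_add:
  "g \<in> vertex_L2 \<rho> \<Longrightarrow> h \<in> vertex_L2 \<rho> \<Longrightarrow> (\<lambda>x. g x + h x) \<in> vertex_L2 \<rho>"
  using vertex_L2_lincomb[of g h 1 1] by simp

lemma vertex_L2_diff:
  "g \<in> vertex_L2 \<rho> \<Longrightarrow> h \<in> vertex_L2 \<rho> \<Longrightarrow> (\<lambda>x. g x - h x) \<in> vertex_L2 \<rho>"
  using vertex_L2_lincomb[of g h 1 "-1"] by simp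

lemma vertex_L2_scale:
  "g \<in> vertex_L2 \<rho> \<Longrightarrow> (\<lambda>x. c * g x) \<in> vertex_L2 \<rho>"
  using vertex_L2_lincomb[of g g c 0] by simp

lemma vertex_L2_abs:
  assumes "g \<in> vertex_L2 \<rho>"
  shows "(\<lambda>x. \<bar>g x\<bar>) \<in> vertex_L2 \<rho>"
  using vertex_L2D[OF assms] by (intro vertex_L2_bound[OF assms]) simp_all

lemma vertex_L2_zero: "(\<lambda>x. 0) \<in> vertex_L2 \<rho>"
  by (simp add: vertex_L2_def square_integrable_def)

lemma vertex_L2_sum:
  assumes "\<And>i. i \<in> I \<Longrightarrow> g i \<in> vertex_L2 \<rho>"
  shows "(\<lambda>x. \<Sum>i\<in>I. g i x) \<in> vertex_L2 \<rho>"
  using assms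
  by (induction I rule: infinite_finite_induct) (auto intro: vertex_L2_zero vertex_L2_add)

lemma vertex_L2_indicator:
  assumes [measurable]: "A \<in> sets borel" and fin: "emeasure \<mu> A < \<infinity>"
  shows "indicator A \<in> vertex_L2 \<rho>"
proof -
  have "emeasure \<rho> (A \<times> UNIV) < \<infinity>"
    unfolding emeasure_rho_cylinder[OF assms(1)] by (rule c_locally_integrable[OF assms])
  then have "integrable \<rho> (indicator (A \<times> UNIV) :: _ \<Rightarrow> real)"
    by (simp add: integrable_indicator_iff)
  also have "indicator (A \<times> UNIV) = (\<lambda>z :: 'a \<times> 'a. (indicator A (fst z))\<^sup>2 :: real)"
    by (auto simp: fun_eq_iff split: split_indicator)
  finally show ?thesis by (simp add: vertex_L2_def square_integrable_def)
qed

lemma D_fin_subset_vertex_L2: "D_fin \<mu> \<subseteq> vertex_L2 \<rho>"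
  unfolding D_fin_def using sets_mu
  by (auto intro!: vertex_L2_sum vertex_L2_scale vertex_L2_indicator)

text \<open>
  The level sets of the function serve as the index set \<open>F\<close> in the definition of \<open>D_fin\<close>; the
  coefficient of a level set is the value of the function at any of its points.
\<close>

lemma finite_range_in_D_fin:
  fixes s :: "'a \<Rightarrow> real"
  assumes [measurable]: "s \<in> borel_measurable borel" and fin: "finite (range s)"
    and A [measurable]: "A \<in> sets borel" and A_fin: "emeasure \<mu> A < \<infinity>"
  shows "(\<lambda>x. indicator A x * s x) \<in> D_fin \<mu>"
proof -
  define R where "R = s ` A"
  define F where "F = (\<lambda>c. A \<inter> s -` {c}) ` R"
  define a where "a B = s (SOME x. x \<in> B)" for B
  have R: "finite R" unfolding R_def using fin by (rule finite_subset[rotated]) auto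
  have a: "a (A \<inter> s -` {c}) = c" if "c \<in> R" for c
  proof -
    have "\<exists>x. x \<in> A \<inter> s -` {c}" using that by (auto simp: R_def)
    from someI_ex[OF this] show ?thesis by (simp add: a_def)
  qed
  have inj: "inj_on (\<lambda>c. A \<inter> s -` {c}) R" using a by (rule inj_on_inverseI)
  have "(\<lambda>x. indicator A x * s x) = (\<lambda>x. \<Sum>B\<in>F. a B * indicator B x)"
  proof
    fix x
    have "(\<Sum>B\<in>F. a B * indicator B x) = (\<Sum>c\<in>R. c * indicator (A \<inter> s -` {c}) x)"
      unfolding F_def by (simp add: sum.reindex[OF inj] a)
    also have "\<dots> = (\<Sum>c\<in>R. if c = s x then indicator A x * s x else 0)"
      by (intro sum.cong) (auto split: split_indicator)
    also have "\<dots> = indicator A x * s x"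
      using R by (auto simp: sum.delta R_def split: split_indicator)
    finally show "indicator A x * s x = (\<Sum>B\<in>F. a B * indicator B x)" by simp
  qed
  moreover have "F \<subseteq> {B \<in> sets \<mu>. emeasure \<mu> B < \<infinity>}"
  proof
    fix B assume "B \<in> F"
    then obtain c where B: "B = A \<inter> s -` {c}" by (auto simp: F_def)
    have "s -` {c} \<inter> space borel \<in> sets borel" by (rule measurable_sets) measurable
    then have "B \<in> sets borel" unfolding B by simp
    moreover have "emeasure \<mu> B \<le> emeasure \<mu> A" unfolding B by (rule emeasure_mono) (auto simp: sets_mu)
    ultimately show "B \<in> {B \<in> sets \<mu>. emeasure \<mu> B < \<infinity>}"
      using A_fin sets_mu le_less_trans by auto
  qed
  moreover have "finite F" using R by (simp add: F_def)
  ultimately show ?thesis unfolding D_fin_def by blast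
qed

text \<open>
  Simple functions \<open>s\<^sub>i \<rightarrow> g\<close> with \<open>\<bar>s\<^sub>i\<bar> \<le> 2 \<bar>g\<bar>\<close>, cut off to sets of finite measure that exhaust the space,
  converge to \<open>g\<close> in \<open>L\<^sup>2(c \<mu>)\<close> by dominated convergence, and the energy norm is bounded by twice the \<open>L\<^sup>2\<close>
  norm.
\<close>

lemma vertex_L2_approx:
  assumes g: "g \<in> vertex_L2 \<rho>"
  shows "g \<in> energy_closure \<rho> (D_fin \<mu>)"
proof -
  obtain A :: "nat \<Rightarrow> 'a set" where A [measurable]: "\<And>i. A i \<in> sets borel" and A_UN: "(\<Union>i. A i) = UNIV"
    and inc: "incseq A" and A_fin: "\<And>i. emeasure \<mu> (A i) < \<infinity>"
    using exhausting_sets by metis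
  have [measurable]: "g \<in> borel_measurable borel" using g by (rule vertex_L2D)
  obtain s where s: "\<And>i. simple_function borel (s i)" "\<And>x. (\<lambda>i. s i x) \<longlonglongrightarrow> g x"
    "\<And>i x. \<bar>s i x\<bar> \<le> 2 * \<bar>g x\<bar>"
    using borel_measurable_implies_sequence_metric[of g borel 0] by (auto simp: dist_real_def)
  have [measurable]: "s i \<in> borel_measurable borel" for i
    using s(1) by (rule borel_measurable_simple_function)
  define t where "t i x = indicator (A i) x * s i x" for i x
  have t_D: "t i \<in> D_fin \<mu>" for i
    unfolding t_def
    using s(1)[of i] A_fin by (intro finite_range_in_D_fin) (auto dest: simple_functionD(1))
  have lim: "(\<lambda>i. g x - t i x) \<longlonglongrightarrow> 0" for x
  proof -
    obtain n where "x \<in> A n" using A_UN by blast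
    then have "x \<in> A i" if "n \<le> i" for i using inc that by (auto simp: incseq_def)
    then have "eventually (\<lambda>i. t i x = s i x) sequentially"
      unfolding t_def eventually_sequentially by (intro exI[of _ n]) simp
    then have "(\<lambda>i. t i x) \<longlonglongrightarrow> g x" using s(2)[of x] by (subst tendsto_cong)
    from tendsto_diff[OF tendsto_const[of "g x"] this] show ?thesis by simp
  qed
  have "\<bar>g x - t i x\<bar> \<le> \<bar>3 * g x\<bar>" for i x
    using s(3)[of i x] by (auto simp: t_def split: split_indicator)
  then have "(\<lambda>i. l2norm \<rho> (\<lambda>z. g (fst z) - t i (fst z))) \<longlonglongrightarrow> 0"
    using lim vertex_L2D(2)[OF vertex_L2_scale[OF g, of 3]]
    by (intro l2norm_dominated[where G="\<lambda>z. 3 * g (fst z)"]) (auto simp: t_def)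
  from tendsto_mult[OF tendsto_const[of 2] this]
  have lim2: "(\<lambda>i. 2 * l2norm \<rho> (\<lambda>z. g (fst z) - t i (fst z))) \<longlonglongrightarrow> 0" by simp
  have "\<exists>h\<in>D_fin \<mu>. energy_norm \<rho> (\<lambda>x. g x - h x) < \<epsilon>" if "0 < \<epsilon>" for \<epsilon>
  proof -
    obtain i where i: "2 * l2norm \<rho> (\<lambda>z. g (fst z) - t i (fst z)) < \<epsilon>"
      using order_tendstoD(2)[OF lim2 \<open>0 < \<epsilon>\<close>] by (auto simp: eventually_sequentially)
    have "(\<lambda>x. g x - t i x) \<in> vertex_L2 \<rho>"
      using g t_D D_fin_subset_vertex_L2 by (intro vertex_L2_diff) auto
    from vertex_L2_finite_energy(2)[OF this] i t_D show ?thesis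
      by (intro bexI[of _ "t i"]) auto
  qed
  then show ?thesis
    using vertex_L2_finite_energy(1)[OF g] by (simp add: energy_closure_def)
qed

lemma energy_closure_D_fin: "energy_closure \<rho> (D_fin \<mu>) = energy_closure \<rho> (vertex_L2 \<rho>)"
proof
  show "energy_closure \<rho> (D_fin \<mu>) \<subseteq> energy_closure \<rho> (vertex_L2 \<rho>)"
    using D_fin_subset_vertex_L2 unfolding energy_closure_def by blast
next
  show "energy_closure \<rho> (vertex_L2 \<rho>) \<subseteq> energy_closure \<rho> (D_fin \<mu>)"
  proof
    fix f assume f: "f \<in> energy_closure \<rho> (vertex_L2 \<rho>)"
    then have fe: "f \<in> finite_energy \<rho>" by (simp add: energy_closure_def)
    have "\<exists>h\<in>D_fin \<mu>. energy_norm \<rho> (\<lambda>x. f x - h x) < \<epsilon>" if "0 < \<epsilon>" for \<epsilon>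
    proof -
      obtain g where g: "g \<in> vertex_L2 \<rho>" "energy_norm \<rho> (\<lambda>x. f x - g x) < \<epsilon> / 2"
        using energy_closureE[OF f half_gt_zero[OF \<open>0 < \<epsilon>\<close>]] .
      obtain h where h: "h \<in> D_fin \<mu>" "energy_norm \<rho> (\<lambda>x. g x - h x) < \<epsilon> / 2"
        using energy_closureE[OF vertex_L2_approx[OF g(1)] half_gt_zero[OF \<open>0 < \<epsilon>\<close>]] .
      have "h \<in> finite_energy \<rho>" "g \<in> finite_energy \<rho>"
        using h g D_fin_subset_vertex_L2 vertex_L2_finite_energy(1) by auto
      from energy_norm_triangle_diff[OF fe this(2,1)] g h show ?thesis
        by (intro bexI[of _ h]) auto
    qed
    with fe show "f \<in> energy_closure \<rho> (D_fin \<mu>)" by (simp add: energy_closure_def)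
  qed
qed

lemma energy_closure_orthogonal:
  assumes f: "f \<in> energy_closure \<rho> D" and D: "D \<subseteq> finite_energy \<rho>"
    and h: "h \<in> finite_energy \<rho>" and orth: "\<And>g. g \<in> D \<Longrightarrow> energy_inner \<rho> g h = 0"
  shows "energy_inner \<rho> f h = 0"
proof (rule ccontr)
  assume ne: "energy_inner \<rho> f h \<noteq> 0"
  have fe: "f \<in> finite_energy \<rho>" using f by (simp add: energy_closure_def)
  have "0 < \<bar>energy_inner \<rho> f h\<bar> / (energy_norm \<rho> h + 1)"
    using ne by (intro divide_pos_pos) (auto intro: add_nonneg_pos)
  then obtain g where g: "g \<in> D"
    "energy_norm \<rho> (\<lambda>x. f x - g x) < \<bar>energy_inner \<rho> f h\<bar> / (energy_norm \<rho> h + 1)"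
    by (rule energy_closureE[OF f])
  have ge: "g \<in> finite_energy \<rho>" using g D by auto
  have "energy_inner \<rho> f h = energy_inner \<rho> (\<lambda>x. f x - g x) h"
    using energy_inner_diff_left[OF fe ge h] orth[OF g(1)] by simp
  then have "\<bar>energy_inner \<rho> f h\<bar> \<le> energy_norm \<rho> (\<lambda>x. f x - g x) * energy_norm \<rho> h"
    using energy_Cauchy_Schwarz[OF finite_energy_diff[OF fe ge] h] by simp
  also have "\<dots> \<le> energy_norm \<rho> (\<lambda>x. f x - g x) * (energy_norm \<rho> h + 1)"
    by (rule mult_left_mono) simp_all
  also have "\<dots> < \<bar>energy_inner \<rho> f h\<bar>"
    using g(2) by (simp add: pos_less_divide_eq add_nonneg_pos)
  finally show False by simp
qed

lemma energy_closure_add: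
  assumes f: "f \<in> energy_closure \<rho> (vertex_L2 \<rho>)" and g: "g \<in> energy_closure \<rho> (vertex_L2 \<rho>)"
  shows "(\<lambda>x. f x + g x) \<in> energy_closure \<rho> (vertex_L2 \<rho>)"
proof -
  have fe: "f \<in> finite_energy \<rho>" "g \<in> finite_energy \<rho>" using f g by (simp_all add: energy_closure_def)
  have "\<exists>h\<in>vertex_L2 \<rho>. energy_norm \<rho> (\<lambda>x. f x + g x - h x) < \<epsilon>" if "0 < \<epsilon>" for \<epsilon>
  proof -
    obtain u where u: "u \<in> vertex_L2 \<rho>" "energy_norm \<rho> (\<lambda>x. f x - u x) < \<epsilon> / 2"
      using energy_closureE[OF f half_gt_zero[OF \<open>0 < \<epsilon>\<close>]] .
    obtain v where v: "v \<in> vertex_L2 \<rho>" "energy_norm \<rho> (\<lambda>x. g x - v x) < \<epsilon> / 2"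
      using energy_closureE[OF g half_gt_zero[OF \<open>0 < \<epsilon>\<close>]] .
    have "energy_norm \<rho> (\<lambda>x. (f x - u x) + (g x - v x)) < \<epsilon>"
      using energy_norm_triangle[OF finite_energy_diff[OF fe(1) vertex_L2_finite_energy(1)[OF u(1)]]
          finite_energy_diff[OF fe(2) vertex_L2_finite_energy(1)[OF v(1)]]] u v by linarith
    then show ?thesis
      using vertex_L2_add[OF u(1) v(1)] by (intro bexI[of _ "\<lambda>x. u x + v x"]) (simp_all add: algebra_simps)
  qed
  then show ?thesis using finite_energy_add[OF fe] by (simp add: energy_closure_def)
qed

lemma energy_closure_closed:
  assumes fe: "f \<in> finite_energy \<rho>"
    and approx: "\<And>\<epsilon>. 0 < \<epsilon> \<Longrightarrow> \<exists>g\<in>energy_closure \<rho> (vertex_L2 \<rho>). energy_norm \<rho> (\<lambda>x. f x - g x) < \<epsilon>"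
  shows "f \<in> energy_closure \<rho> (vertex_L2 \<rho>)"
proof -
  have "\<exists>h\<in>vertex_L2 \<rho>. energy_norm \<rho> (\<lambda>x. f x - h x) < \<epsilon>" if "0 < \<epsilon>" for \<epsilon>
  proof -
    obtain g where g: "g \<in> energy_closure \<rho> (vertex_L2 \<rho>)" "energy_norm \<rho> (\<lambda>x. f x - g x) < \<epsilon> / 2"
      using approx[OF half_gt_zero[OF \<open>0 < \<epsilon>\<close>]] by blast
    obtain h where h: "h \<in> vertex_L2 \<rho>" "energy_norm \<rho> (\<lambda>x. g x - h x) < \<epsilon> / 2"
      using energy_closureE[OF g(1) half_gt_zero[OF \<open>0 < \<epsilon>\<close>]] .
    have "g \<in> finite_energy \<rho>" using g(1) by (simp add: energy_closure_def)
    from energy_norm_triangle_diff[OF fe this vertex_L2_finite_energy(1)[OF h(1)]] g h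
    show ?thesis by (intro bexI[of _ h]) auto
  qed
  with fe show ?thesis by (simp add: energy_closure_def)
qed

end

section \<open>Invariant sets and recurrence\<close>

text \<open>
  No mass of \<open>\<rho>\<close> connects \<open>Z\<close> with its complement, so the energy form is the sum of its restrictions
  to \<open>Z\<close> and to \<open>- Z\<close>.
\<close>

definition rho_invariant :: "('a::topological_space \<times> 'a) measure \<Rightarrow> 'a set \<Rightarrow> bool" where
  "rho_invariant \<rho> Z \<longleftrightarrow> Z \<in> sets borel \<and> (AE z in \<rho>. fst z \<in> Z \<longleftrightarrow> snd z \<in> Z)"

lemma rho_invariant_Compl: "rho_invariant \<rho> Z \<Longrightarrow> rho_invariant \<rho> (- Z)"
  by (auto simp: rho_invariant_def elim!: eventually_mono)

lemma AE_square_not_at_top: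
  assumes F: "\<And>n. square_integrable M (F n)" and C: "\<And>n. l2norm M (F n) \<le> C"
  shows "AE z in M. \<not> filterlim (\<lambda>n. (F n z)\<^sup>2) at_top sequentially"
proof -
  have [measurable]: "F n \<in> borel_measurable M" for n using F by (rule square_integrableD)
  have "(\<integral>\<^sup>+ z. liminf (\<lambda>n. ennreal ((F n z)\<^sup>2)) \<partial>M) \<noteq> \<infinity>"
    using liminf_square_bounded[of M F C, OF F C] by (auto simp: top_unique)
  then have "AE z in M. liminf (\<lambda>n. ennreal ((F n z)\<^sup>2)) \<noteq> \<infinity>"
    by (rule nn_integral_noteq_infinite[rotated]) measurable
  then show ?thesis
  proof eventually_elim
    fix z assume fin: "liminf (\<lambda>n. ennreal ((F n z)\<^sup>2)) \<noteq> \<infinity>"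
    show "\<not> filterlim (\<lambda>n. (F n z)\<^sup>2) at_top sequentially"
    proof
      assume lim: "filterlim (\<lambda>n. (F n z)\<^sup>2) at_top sequentially"
      have "of_nat k \<le> liminf (\<lambda>n. ennreal ((F n z)\<^sup>2))" for k :: nat
      proof (rule Liminf_bounded)
        have "eventually (\<lambda>n. real k \<le> (F n z)\<^sup>2) sequentially"
          using lim by (simp add: filterlim_at_top)
        then show "eventually (\<lambda>n. of_nat k \<le> ennreal ((F n z)\<^sup>2)) sequentially"
          by eventually_elim (auto dest: ennreal_leI simp: ennreal_of_nat_eq_real_of_nat)
      qed
      then have "(SUP k. of_nat k :: ennreal) \<le> liminf (\<lambda>n. ennreal ((F n z)\<^sup>2))"
        by (intro SUP_least)
      with fin show False by (simp add: ennreal_SUP_of_nat_eq_top top_unique)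
    qed
  qed
qed

context symmetric_measure_setting
begin

text \<open>
  Multiplication by the indicator of an invariant set commutes with the gradient; hence it is an
  orthogonal projection for the energy form.
\<close>

lemma AE_grad_indicator:
  assumes "rho_invariant \<rho> Z"
  shows "AE z in \<rho>. grad (\<lambda>x. indicator Z x * f x) z = indicator Z (fst z) * grad f z"
  using assms unfolding rho_invariant_def
  by (auto simp: grad_def algebra_simps split: split_indicator elim!: eventually_mono)

lemma finite_energy_indicator:
  assumes Z: "rho_invariant \<rho> Z" and f: "f \<in> finite_energy \<rho>"
  shows "(\<lambda>x. indicator Z x * f x) \<in> finite_energy \<rho>"
    and "energy_norm \<rho> (\<lambda>x. indicator Z x * f x) \<le> energy_norm \<rho> f"
proof -
  have [measurable]: "Z \<in> sets borel" "f \<in> borel_measurable borel"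
    using Z f by (simp_all add: rho_invariant_def finite_energyD)
  have "AE z in \<rho>. \<bar>grad (\<lambda>x. indicator Z x * f x) z\<bar> \<le> \<bar>grad f z\<bar>"
    using AE_grad_indicator[OF Z, of f] by eventually_elim (auto split: split_indicator)
  then show "(\<lambda>x. indicator Z x * f x) \<in> finite_energy \<rho>"
    and "energy_norm \<rho> (\<lambda>x. indicator Z x * f x) \<le> energy_norm \<rho> f"
    by (intro finite_energy_contraction[OF f]; measurable)+
qed

lemma vertex_L2_indicator_mult:
  assumes Z: "rho_invariant \<rho> Z" and g: "g \<in> vertex_L2 \<rho>"
  shows "(\<lambda>x. indicator Z x * g x) \<in> vertex_L2 \<rho>"
proof (rule vertex_L2_bound[OF g])
  have [measurable]: "Z \<in> sets borel" "g \<in> borel_measurable borel"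
    using Z g by (simp_all add: rho_invariant_def vertex_L2D)
  show "(\<lambda>x. indicator Z x * g x) \<in> borel_measurable borel" by measurable
qed (auto split: split_indicator)

lemma energy_inner_indicator:
  assumes Z: "rho_invariant \<rho> Z" and f: "f \<in> finite_energy \<rho>" and g: "g \<in> finite_energy \<rho>"
  shows "energy_inner \<rho> (\<lambda>x. indicator Z x * f x) g = energy_inner \<rho> f (\<lambda>x. indicator Z x * g x)"
proof -
  have [measurable]: "Z \<in> sets borel" "f \<in> borel_measurable borel" "g \<in> borel_measurable borel"
    using Z f g by (simp_all add: rho_invariant_def finite_energyD)
  have "(\<integral>z. grad (\<lambda>x. indicator Z x * f x) z * grad g z \<partial>\<rho>)
      = (\<integral>z. grad f z * grad (\<lambda>x. indicator Z x * g x) z \<partial>\<rho>)"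
  proof (rule integral_cong_AE)
    show "AE z in \<rho>. grad (\<lambda>x. indicator Z x * f x) z * grad g z
        = grad f z * grad (\<lambda>x. indicator Z x * g x) z"
      using AE_grad_indicator[OF Z, of f] AE_grad_indicator[OF Z, of g] by eventually_elim simp
  qed measurable
  then show ?thesis by (simp add: energy_inner_grad)
qed

text \<open>
  If \<open>x\<close> belongs to the explosion set and \<open>y\<close> does not, then \<open>S n x - S n y\<close> tends to infinity.  Bounded
  energy excludes this for \<open>\<rho>\<close>-almost all pairs.
\<close>

lemma rho_invariant_explosion:
  assumes S: "\<And>n. S n \<in> finite_energy \<rho>" and C: "\<And>n. energy_norm \<rho> (S n) \<le> C"
    and mono: "\<And>x. incseq (\<lambda>n. S n x)"
  shows "rho_invariant \<rho> {x. filterlim (\<lambda>n. S n x) at_top sequentially}"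
proof -
  let ?Z = "{x. filterlim (\<lambda>n. S n x) at_top sequentially}"
  have bdd: "\<exists>k. \<forall>n. S n x < real k" if "x \<notin> ?Z" for x
  proof (rule ccontr)
    assume "\<nexists>k. \<forall>n. S n x < real k"
    then have ex: "\<exists>n. real k \<le> S n x" for k by (auto simp: not_less)
    have "filterlim (\<lambda>n. S n x) at_top sequentially"
      unfolding filterlim_at_top
    proof
      fix B :: real
      obtain n where "real (nat \<lceil>B\<rceil>) \<le> S n x" using ex by blast
      then have "B \<le> S n x" by linarith
      then show "eventually (\<lambda>n. B \<le> S n x) sequentially"
        using mono[of x] unfolding eventually_sequentially incseq_def by (meson order_trans)
    qed
    with that show False by simp
  qed
  have Z_eq: "?Z = {x. \<forall>k::nat. \<exists>n. real k \<le> S n x}"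
  proof (intro equalityI subsetI CollectI allI)
    fix x k assume "x \<in> ?Z"
    then have "eventually (\<lambda>n. real k \<le> S n x) sequentially" by (simp add: filterlim_at_top)
    then show "\<exists>n. real k \<le> S n x" by (auto simp: eventually_sequentially)
  next
    fix x assume "x \<in> {x. \<forall>k::nat. \<exists>n. real k \<le> S n x}"
    then show "filterlim (\<lambda>n. S n x) at_top sequentially"
      using bdd[of x] by (auto simp: not_less[symmetric])
  qed
  have meas [measurable]: "S n \<in> borel_measurable borel" for n using S by (rule finite_energyD)
  have Z: "?Z \<in> sets borel" unfolding Z_eq by measurable
  have blowup: "filterlim (\<lambda>n. (S n x - S n y)\<^sup>2) at_top sequentially" if x: "x \<in> ?Z" and y: "y \<notin> ?Z" for x y
  proof -
    obtain k where k: "\<And>n. S n y < real k" using bdd[OF y] by blast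
    have "filterlim (\<lambda>n. - real k + S n x) at_top sequentially"
      using x by (intro filterlim_tendsto_add_at_top[OF tendsto_const]) simp
    then have "filterlim (\<lambda>n. S n x - S n y) at_top sequentially"
      by (rule filterlim_at_top_mono) (use k in \<open>auto intro: less_imp_le simp: eventually_sequentially\<close>)
    then show ?thesis by (intro filterlim_pow_at_top) simp_all
  qed
  have "AE z in \<rho>. \<not> filterlim (\<lambda>n. (grad (S n) z)\<^sup>2) at_top sequentially"
  proof (rule AE_square_not_at_top)
    show "square_integrable \<rho> (grad (S n))" for n using S by (rule finite_energyD)
    show "l2norm \<rho> (grad (S n)) \<le> C * sqrt 2" for n
      using C[of n] by (simp add: energy_norm_grad field_simps)
  qed
  then have "AE z in \<rho>. fst z \<in> ?Z \<longleftrightarrow> snd z \<in> ?Z"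
  proof eventually_elim
    fix z assume fin: "\<not> filterlim (\<lambda>n. (grad (S n) z)\<^sup>2) at_top sequentially"
    have "(S n (snd z) - S n (fst z))\<^sup>2 = (grad (S n) z)\<^sup>2" for n
      by (simp add: grad_def power2_commute)
    then show "fst z \<in> ?Z \<longleftrightarrow> snd z \<in> ?Z"
      using fin blowup[of "fst z" "snd z"] blowup[of "snd z" "fst z"] by (auto simp: grad_def)
  qed
  with Z show ?thesis by (simp add: rho_invariant_def)
qed

text \<open>
  The functions \<open>v n = min 1 (S n / k)\<close> tend to \<open>1\<close> on \<open>Z\<close> and have energy norm at most \<open>C / k\<close>, so \<open>Z\<close> is
  recurrent: its indicator is a limit of test functions at no cost in energy.  For bounded \<open>f\<close> the product rule
  \<open>\<nabla>(f (1 - v)) = (1 - v) \<nabla>f - f \<nabla>v\<close> splits the error of the approximation \<open>f v n\<close> into a part that vanishes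
  by dominated convergence as \<open>n \<rightarrow> \<infinity>\<close> and a part that is small when \<open>k\<close> is large.
\<close>

lemma recurrent_approx_bounded:
  assumes Z: "rho_invariant \<rho> Z" and S: "\<And>n. S n \<in> vertex_L2 \<rho>" and nonneg: "\<And>n x. 0 \<le> S n x"
    and C: "\<And>n. energy_norm \<rho> (S n) \<le> C"
    and lim: "\<And>x. x \<in> Z \<Longrightarrow> filterlim (\<lambda>n. S n x) at_top sequentially"
    and f: "f \<in> finite_energy \<rho>" and B: "\<And>x. \<bar>f x\<bar> \<le> B"
  shows "(\<lambda>x. indicator Z x * f x) \<in> energy_closure \<rho> (vertex_L2 \<rho>)"
proof -
  have [measurable]: "Z \<in> sets borel" "f \<in> borel_measurable borel" "\<And>n. S n \<in> borel_measurable borel"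
    using Z f S by (auto simp: rho_invariant_def finite_energyD vertex_L2D)
  have C0: "0 \<le> C" using C[of 0] energy_norm_nonneg[of \<rho> "S 0"] by linarith
  have B0: "0 \<le> B" using B[of undefined] by linarith
  have "\<exists>g\<in>vertex_L2 \<rho>. energy_norm \<rho> (\<lambda>x. indicator Z x * f x - g x) < \<epsilon>" if "0 < \<epsilon>" for \<epsilon>
  proof -
    \<comment> \<open>The summand 1 keeps k positive when B or C is zero.\<close>
    define k where "k = (2 * B * C + 1) / \<epsilon>"
    have k: "0 < k" using B0 C0 \<open>0 < \<epsilon>\<close> by (auto simp: k_def intro!: divide_pos_pos add_nonneg_pos)
    have Bk: "B * (C / k) < \<epsilon> / 2"
    proof -
      have "0 \<le> B * C" using B0 C0 by simp
      then have "B * (C / k) = \<epsilon> * (B * C / (2 * (B * C) + 1))" and "B * C / (2 * (B * C) + 1) < 1 / 2"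
        using \<open>0 < \<epsilon>\<close> by (simp_all add: k_def pos_divide_less_eq mult.assoc)
      then show ?thesis using mult_strict_left_mono[of "B * C / (2 * (B * C) + 1)" "1/2" \<epsilon>] \<open>0 < \<epsilon>\<close> by simp
    qed
    define v where "v n x = min 1 (S n x / k)" for n x
    have v01: "0 \<le> v n x" "v n x \<le> 1" for n x using nonneg[of n x] k by (auto simp: v_def)
    have [measurable]: "v n \<in> borel_measurable borel" for n unfolding v_def by measurable
    have Sk: "(\<lambda>x. S n x / k) \<in> vertex_L2 \<rho>" for n using vertex_L2_scale[OF S, of "1 / k"] by simp
    have v: "v n \<in> vertex_L2 \<rho>" for n
      using nonneg[of n] k by (intro vertex_L2_bound[OF Sk[of n]]) (auto simp: v_def)
    have "energy_norm \<rho> (v n) \<le> energy_norm \<rho> (\<lambda>x. S n x / k)" for n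
      by (intro finite_energy_contraction(2)[OF vertex_L2_finite_energy(1)[OF Sk[of n]]] AE_I2)
         (auto simp: v_def grad_def)
    also have "energy_norm \<rho> (\<lambda>x. S n x / k) \<le> C / k" for n
      using energy_norm_scale[of \<rho> "1 / k" "S n"] C[of n] k by (simp add: divide_right_mono)
    finally have v_norm: "energy_norm \<rho> (v n) \<le> C / k" for n .
    define g where "g n x = indicator Z x * f x * v n x" for n x
    have g: "g n \<in> vertex_L2 \<rho>" for n
    proof (rule vertex_L2_bound[OF vertex_L2_scale[OF v[of n], of B]])
      show "\<bar>g n x\<bar> \<le> \<bar>B * v n x\<bar>" for x
        using B[of x] B0 by (auto simp: g_def abs_mult mult_right_mono split: split_indicator)
      show "g n \<in> borel_measurable borel" unfolding g_def by measurable
    qed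
    \<comment> \<open>The two terms of the product rule; f is evaluated at the second coordinate in Q so that
      the splitting is exact for finite differences.\<close>
    define P where "P n z = indicator Z (fst z) * (1 - v n (fst z)) * grad f z" for n and z :: "'a \<times> 'a"
    define Q where "Q n z = - indicator Z (fst z) * f (snd z) * grad (v n) z" for n and z :: "'a \<times> 'a"
    have [measurable]: "P n \<in> borel_measurable \<rho>" "Q n \<in> borel_measurable \<rho>" for n
      unfolding P_def Q_def by measurable
    have split: "AE z in \<rho>. grad (\<lambda>x. indicator Z x * f x - g n x) z = P n z + Q n z" for n
      using AE_grad_indicator[OF Z, of "\<lambda>x. f x * (1 - v n x)"]
    proof eventually_elim
      fix z assume *: "grad (\<lambda>x. indicator Z x * (f x * (1 - v n x))) z
          = indicator Z (fst z) * grad (\<lambda>x. f x * (1 - v n x)) z"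
      have "(\<lambda>x. indicator Z x * f x - g n x) = (\<lambda>x. indicator Z x * (f x * (1 - v n x)))"
        by (simp add: g_def fun_eq_iff algebra_simps)
      with * show "grad (\<lambda>x. indicator Z x * f x - g n x) z = P n z + Q n z"
        by (simp add: P_def Q_def grad_def algebra_simps)
    qed
    have P_le: "\<bar>P n z\<bar> \<le> \<bar>grad f z\<bar>" for n z
      using v01[of n "fst z"]
      by (auto simp: P_def abs_mult mult_left_le_one_le split: split_indicator)
    have Q_le: "\<bar>Q n z\<bar> \<le> \<bar>B * grad (v n) z\<bar>" for n z
      using B[of "snd z"] B0 by (auto simp: Q_def abs_mult mult_right_mono split: split_indicator)
    have P: "square_integrable \<rho> (P n)" for n
      using P_le by (intro square_integrable_bound(1)[OF finite_energyD(2)[OF f]]) auto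
    have "square_integrable \<rho> (\<lambda>z. B * grad (v n) z)" for n
      using finite_energyD(2)[OF finite_energy_scale[OF vertex_L2_finite_energy(1)[OF v[of n]], of B]]
      by (simp add: grad_scale)
    then have Q: "square_integrable \<rho> (Q n)" and Q_norm: "l2norm \<rho> (Q n) \<le> B * l2norm \<rho> (grad (v n))" for n
      using square_integrable_bound[of \<rho> "\<lambda>z. B * grad (v n) z" "Q n"] Q_le[of n] B0
      by (simp_all add: l2norm_scale)
    have "(\<lambda>n. l2norm \<rho> (P n)) \<longlonglongrightarrow> 0"
    proof (rule l2norm_dominated[OF finite_energyD(2)[OF f]])
      have "(\<lambda>n. P n z) \<longlonglongrightarrow> 0" for z
      proof (cases "fst z \<in> Z")
        case True
        have "eventually (\<lambda>n. k \<le> S n (fst z)) sequentially"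
          using lim[OF True] by (simp add: filterlim_at_top)
        then have "eventually (\<lambda>n. P n z = 0) sequentially"
          by eventually_elim (use k in \<open>simp add: P_def v_def min_def\<close>)
        then show ?thesis by (rule tendsto_eventually)
      qed (simp add: P_def)
      then show "AE z in \<rho>. (\<lambda>n. P n z) \<longlonglongrightarrow> 0" by simp
    qed (use P_le in auto)
    then have "eventually (\<lambda>n. l2norm \<rho> (P n) < \<epsilon> / 2) sequentially"
      by (rule order_tendstoD(2)) (use \<open>0 < \<epsilon>\<close> in simp)
    then obtain n where n: "l2norm \<rho> (P n) < \<epsilon> / 2" by (auto simp: eventually_sequentially)
    have h: "grad (\<lambda>x. indicator Z x * f x - g n x) \<in> borel_measurable \<rho>"
      using measurable_grad[of "\<lambda>x. indicator Z x * f x - g n x"] vertex_L2D(1)[OF g[of n]] by simp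
    have "l2norm \<rho> (grad (\<lambda>x. indicator Z x * f x - g n x)) \<le> l2norm \<rho> (\<lambda>z. P n z + Q n z)"
      using split[of n]
      by (intro square_integrable_bound(2)[OF square_integrable_add[OF P Q] h]) (auto elim: eventually_mono)
    also have "\<dots> \<le> l2norm \<rho> (P n) + l2norm \<rho> (Q n)" by (rule l2norm_triangle[OF P Q])
    also have "\<dots> \<le> l2norm \<rho> (P n) + B * l2norm \<rho> (grad (v n))" using Q_norm[of n] by simp
    finally have "energy_norm \<rho> (\<lambda>x. indicator Z x * f x - g n x)
        \<le> (l2norm \<rho> (P n) + B * l2norm \<rho> (grad (v n))) / sqrt 2"
      by (simp add: energy_norm_grad divide_right_mono)
    also have "\<dots> = l2norm \<rho> (P n) / sqrt 2 + B * energy_norm \<rho> (v n)"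
      by (simp add: energy_norm_grad add_divide_distrib)
    also have "\<dots> \<le> l2norm \<rho> (P n) + B * (C / k)"
      using v_norm[of n] B0 l2norm_nonneg[of \<rho> "P n"]
      by (intro add_mono mult_left_mono) (simp_all add: divide_le_eq mult_le_cancel_left1 not_less)
    also have "\<dots> < \<epsilon>" using add_strict_mono[OF n Bk] by (simp only: field_sum_of_halves)
    finally show ?thesis using g by blast
  qed
  then show ?thesis using finite_energy_indicator(1)[OF Z f] by (simp add: energy_closure_def)
qed

text \<open>
  The unbounded case follows from the bounded one, because truncations converge in energy.
\<close>

lemma recurrent_approx:
  assumes Z: "rho_invariant \<rho> Z" and S: "\<And>n. S n \<in> vertex_L2 \<rho>" and nonneg: "\<And>n x. 0 \<le> S n x"
    and C: "\<And>n. energy_norm \<rho> (S n) \<le> C"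
    and lim: "\<And>x. x \<in> Z \<Longrightarrow> filterlim (\<lambda>n. S n x) at_top sequentially"
    and f: "f \<in> finite_energy \<rho>"
  shows "(\<lambda>x. indicator Z x * f x) \<in> energy_closure \<rho> (vertex_L2 \<rho>)"
proof (rule energy_closure_closed[OF finite_energy_indicator(1)[OF Z f]])
  fix \<epsilon> :: real assume "0 < \<epsilon>"
  have [measurable]: "Z \<in> sets borel" "f \<in> borel_measurable borel"
    using Z f by (auto simp: rho_invariant_def finite_energyD)
  define t where "t n x = max (- real n) (min (real n) (f x))" for n x
  have [measurable]: "t n \<in> borel_measurable borel" for n unfolding t_def by measurable
  have t_fe: "t n \<in> finite_energy \<rho>" for n
    by (rule finite_energy_contraction(1)[OF f]) (auto simp: t_def grad_def)
  have t: "(\<lambda>x. indicator Z x * t n x) \<in> energy_closure \<rho> (vertex_L2 \<rho>)" for n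
    by (rule recurrent_approx_bounded[OF Z S nonneg C lim t_fe, where B="real n"]) (auto simp: t_def)
  have "(\<lambda>n. energy_norm \<rho> (\<lambda>x. indicator Z x * (f x - t n x))) \<longlonglongrightarrow> 0"
  proof (rule energy_norm_dominated[OF f])
    show "AE z in \<rho>. \<bar>grad (\<lambda>x. indicator Z x * (f x - t n x)) z\<bar> \<le> \<bar>grad f z\<bar>" for n
      using AE_grad_indicator[OF Z, of "\<lambda>x. f x - t n x"]
    proof eventually_elim
      fix z assume *: "grad (\<lambda>x. indicator Z x * (f x - t n x)) z
          = indicator Z (fst z) * grad (\<lambda>x. f x - t n x) z"
      have "\<bar>grad (\<lambda>x. f x - t n x) z\<bar> \<le> \<bar>grad f z\<bar>" by (auto simp: t_def grad_def)
      then show "\<bar>grad (\<lambda>x. indicator Z x * (f x - t n x)) z\<bar> \<le> \<bar>grad f z\<bar>"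
        unfolding * by (auto split: split_indicator)
    qed
    show "(\<lambda>n. indicator Z x * (f x - t n x)) \<longlonglongrightarrow> 0" for x
    proof (rule tendsto_eventually)
      have "t n x = f x" if "nat \<lceil>\<bar>f x\<bar>\<rceil> \<le> n" for n
        using that by (auto simp: t_def)
      then show "eventually (\<lambda>n. indicator Z x * (f x - t n x) = 0) sequentially"
        unfolding eventually_sequentially by (intro exI[of _ "nat \<lceil>\<bar>f x\<bar>\<rceil>"]) simp
    qed
  qed measurable
  from order_tendstoD(2)[OF this \<open>0 < \<epsilon>\<close>]
  obtain n where "energy_norm \<rho> (\<lambda>x. indicator Z x * (f x - t n x)) < \<epsilon>"
    by (auto simp: eventually_sequentially)
  then show "\<exists>g\<in>energy_closure \<rho> (vertex_L2 \<rho>). energy_norm \<rho> (\<lambda>x. indicator Z x * f x - g x) < \<epsilon>"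
    using t by (intro bexI[of _ "\<lambda>x. indicator Z x * t n x"]) (simp_all add: algebra_simps)
qed

end

section \<open>The projection onto the closure\<close>

context symmetric_measure_setting
begin

lemma energy_norm_sq_lincomb:
  assumes f: "f \<in> finite_energy \<rho>" and g: "g \<in> finite_energy \<rho>"
  shows "(energy_norm \<rho> (\<lambda>x. f x + t * g x))\<^sup>2
    = (energy_norm \<rho> f)\<^sup>2 + 2 * t * energy_inner \<rho> f g + t\<^sup>2 * (energy_norm \<rho> g)\<^sup>2"
proof -
  note tg = finite_energy_scale[OF g, of t]
  have left: "energy_inner \<rho> (\<lambda>x. f x + t * g x) h = energy_inner \<rho> f h + t * energy_inner \<rho> g h"
    if "h \<in> finite_energy \<rho>" for h
    using energy_inner_add_left[OF f tg that] by (simp add: energy_inner_scale_left)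
  have "(energy_norm \<rho> (\<lambda>x. f x + t * g x))\<^sup>2
      = energy_inner \<rho> f (\<lambda>x. f x + t * g x) + t * energy_inner \<rho> g (\<lambda>x. f x + t * g x)"
    unfolding energy_norm_sq by (rule left[OF finite_energy_add[OF f tg]])
  also have "\<dots> = energy_inner \<rho> f f + 2 * t * energy_inner \<rho> f g + t\<^sup>2 * energy_inner \<rho> g g"
    using left[OF f] left[OF g] energy_inner_commute[of \<rho> _ "\<lambda>x. f x + t * g x"]
    by (simp add: energy_inner_commute[of \<rho> g f] power2_eq_square algebra_simps)
  finally show ?thesis by (simp add: energy_norm_sq)
qed

text \<open>
  The parallelogram law makes minimising sequences Cauchy, and a minimising sequence becomes
  asymptotically orthogonal to the subspace.  Only the distances enter, so a limit is not needed at
  this stage.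
\<close>

lemma minimising_sequence:
  assumes f: "f \<in> finite_energy \<rho>"
  obtains u where "\<And>n. u n \<in> vertex_L2 \<rho>"
    "\<And>m n. m \<le> n \<Longrightarrow> energy_norm \<rho> (\<lambda>x. u n x - u m x) \<le> (1/2) ^ m"
    "\<And>g. g \<in> vertex_L2 \<rho> \<Longrightarrow> (\<lambda>n. energy_inner \<rho> (\<lambda>x. f x - u n x) g) \<longlonglongrightarrow> 0"
proof -
  define d where "d = (INF u\<in>vertex_L2 \<rho>. (energy_norm \<rho> (\<lambda>x. f x - u x))\<^sup>2)"
  have bdd: "bdd_below ((\<lambda>u. (energy_norm \<rho> (\<lambda>x. f x - u x))\<^sup>2) ` vertex_L2 \<rho>)"
    by (rule bdd_belowI[of _ 0]) auto
  have d_le: "d \<le> (energy_norm \<rho> (\<lambda>x. f x - u x))\<^sup>2" if "u \<in> vertex_L2 \<rho>" for u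
    unfolding d_def by (rule cINF_lower[OF bdd that])
  have "\<exists>u\<in>vertex_L2 \<rho>. (energy_norm \<rho> (\<lambda>x. f x - u x))\<^sup>2 < d + (1/4) ^ Suc n" for n
  proof -
    have "d < d + (1/4) ^ Suc n" by simp
    then show ?thesis
      unfolding d_def using cINF_less_iff[OF _ bdd] vertex_L2_zero by blast
  qed
  then obtain u where u: "\<And>n. u n \<in> vertex_L2 \<rho>"
    and u_lt: "\<And>n. (energy_norm \<rho> (\<lambda>x. f x - u n x))\<^sup>2 < d + (1/4) ^ Suc n" by metis
  have w: "(\<lambda>x. f x - u n x) \<in> finite_energy \<rho>" for n
    by (intro finite_energy_diff f vertex_L2_finite_energy(1) u)
  show ?thesis
  proof (rule that[OF u])
    fix m n :: nat assume "m \<le> n"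
    let ?a = "\<lambda>x. f x - u m x" and ?b = "\<lambda>x. f x - u n x"
    \<comment> \<open>The midpoint competes in the infimum, so the sum of the two error functions has energy norm
      squared at least 4 d.\<close>
    have "(\<lambda>x. 1 / 2 * u m x + 1 / 2 * u n x) \<in> vertex_L2 \<rho>" by (intro vertex_L2_lincomb u)
    from d_le[OF this] have "4 * d \<le> (2 * energy_norm \<rho> (\<lambda>x. f x - (1 / 2 * u m x + 1 / 2 * u n x)))\<^sup>2"
      by (simp add: power_mult_distrib)
    also have "2 * energy_norm \<rho> (\<lambda>x. f x - (1 / 2 * u m x + 1 / 2 * u n x))
        = energy_norm \<rho> (\<lambda>x. 2 * (f x - (1 / 2 * u m x + 1 / 2 * u n x)))"
      by (simp only: energy_norm_scale)
    also have "(\<lambda>x. 2 * (f x - (1 / 2 * u m x + 1 / 2 * u n x))) = (\<lambda>x. ?a x + 1 * ?b x)"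
      by (simp add: fun_eq_iff algebra_simps)
    finally have "4 * d \<le> (energy_norm \<rho> (\<lambda>x. ?a x + 1 * ?b x))\<^sup>2" .
    moreover have "(\<lambda>x. u n x - u m x) = (\<lambda>x. ?a x + (-1) * ?b x)" by (simp add: fun_eq_iff)
    ultimately have "(energy_norm \<rho> (\<lambda>x. u n x - u m x))\<^sup>2
        \<le> 2 * (energy_norm \<rho> ?a)\<^sup>2 + 2 * (energy_norm \<rho> ?b)\<^sup>2 - 4 * d"
      using energy_norm_sq_lincomb[OF w[of m] w[of n], of 1]
        energy_norm_sq_lincomb[OF w[of m] w[of n], of "-1"] by simp
    also have "\<dots> \<le> 2 * (1/4) ^ Suc m + 2 * (1/4) ^ Suc n"
      using u_lt[of m] u_lt[of n] by simp
    also have "\<dots> \<le> (1/4) ^ m"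
    proof -
      have "(1/4 :: real) ^ n \<le> (1/4) ^ m" by (rule power_decreasing[OF \<open>m \<le> n\<close>]) simp_all
      then show ?thesis unfolding power_Suc by linarith
    qed
    also have "(1/4 :: real) ^ m = ((1/2) ^ m)\<^sup>2"
      by (simp add: power_mult[symmetric] power_mult[of _ 2] mult.commute[of m] power_one_over)
    finally show "energy_norm \<rho> (\<lambda>x. u n x - u m x) \<le> (1/2) ^ m"
      by (rule power2_le_imp_le) simp
  next
    fix g assume g: "g \<in> vertex_L2 \<rho>"
    let ?c = "(energy_norm \<rho> g)\<^sup>2"
    \<comment> \<open>Compare with the competitor u n - t g; the choice t = 1/2^n below balances both terms.\<close>
    have key: "- 2 * t * energy_inner \<rho> (\<lambda>x. f x - u n x) g \<le> (1/4) ^ n + t\<^sup>2 * ?c" for n t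
    proof -
      have "(\<lambda>x. u n x - t * g x) \<in> vertex_L2 \<rho>"
        using vertex_L2_lincomb[OF u[of n] g, of 1 "-t"] by simp
      moreover have "(\<lambda>x. f x - (u n x - t * g x)) = (\<lambda>x. (f x - u n x) + t * g x)"
        by (simp add: fun_eq_iff)
      ultimately have "d \<le> (energy_norm \<rho> (\<lambda>x. (f x - u n x) + t * g x))\<^sup>2"
        using d_le[of "\<lambda>x. u n x - t * g x"] by simp
      moreover have "(1/4 :: real) ^ Suc n \<le> (1/4) ^ n" by simp
      ultimately show ?thesis
        using energy_norm_sq_lincomb[OF w[of n] vertex_L2_finite_energy(1)[OF g], of t] u_lt[of n]
        by linarith
    qed
    have bound: "\<bar>energy_inner \<rho> (\<lambda>x. f x - u n x) g\<bar> \<le> (1/2) ^ n * (1 + ?c)" for n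
    proof -
      let ?b = "energy_inner \<rho> (\<lambda>x. f x - u n x) g" and ?t = "(1/2 :: real) ^ n"
      have t: "(1/4 :: real) ^ n = ?t * ?t" by (simp add: power_mult_distrib[symmetric])
      have "?t * (2 * \<bar>?b\<bar>) \<le> ?t * (?t * (1 + ?c))"
        using key[of ?t n] key[of "- ?t" n] by (simp add: t power2_eq_square abs_if algebra_simps)
      then have "2 * \<bar>?b\<bar> \<le> ?t * (1 + ?c)" by (simp add: mult_le_cancel_left)
      then show ?thesis by linarith
    qed
    show "(\<lambda>n. energy_inner \<rho> (\<lambda>x. f x - u n x) g) \<longlonglongrightarrow> 0"
    proof (rule Lim_null_comparison)
      show "(\<lambda>n. (1/2) ^ n * (1 + ?c)) \<longlonglongrightarrow> 0"
        by (intro tendsto_mult_left_zero LIMSEQ_realpow_zero) simp_all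
      show "\<forall>\<^sub>F n in sequentially. norm (energy_inner \<rho> (\<lambda>x. f x - u n x) g) \<le> (1/2) ^ n * (1 + ?c)"
        unfolding real_norm_def by (intro always_eventually allI bound)
    qed
  qed
qed

text \<open>
  The projection is \<open>f\<close> on the recurrent part \<open>Z\<close> and the pointwise limit \<open>U\<close> of the minimising sequence
  elsewhere.  On \<open>Z\<close> the sequence may fail to converge even after subtracting constants, which is why
  \<open>f\<close> itself has to be used there.
\<close>

lemma orthogonal_projection_exists:
  assumes f: "f \<in> finite_energy \<rho>"
  obtains a where "a \<in> energy_closure \<rho> (vertex_L2 \<rho>)"
    "\<And>g. g \<in> vertex_L2 \<rho> \<Longrightarrow> energy_inner \<rho> (\<lambda>x. f x - a x) g = 0"
proof (rule minimising_sequence[OF f])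
  fix u :: "nat \<Rightarrow> 'a \<Rightarrow> real"
  assume u: "\<And>n. u n \<in> vertex_L2 \<rho>"
    and cauchy: "\<And>m n. m \<le> n \<Longrightarrow> energy_norm \<rho> (\<lambda>x. u n x - u m x) \<le> (1/2) ^ m"
    and orth: "\<And>g. g \<in> vertex_L2 \<rho> \<Longrightarrow> (\<lambda>n. energy_inner \<rho> (\<lambda>x. f x - u n x) g) \<longlonglongrightarrow> 0"
  have u_fe: "u n \<in> finite_energy \<rho>" for n using u by (rule vertex_L2_finite_energy)
  have [measurable]: "u n \<in> borel_measurable borel" for n using u by (rule vertex_L2D)
  define s where "s n x = \<bar>u (Suc n) x - u n x\<bar>" for n x
  define S where "S N x = (\<Sum>n<N. s n x)" for N x
  have s: "s n \<in> vertex_L2 \<rho>" for n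
    unfolding s_def by (intro vertex_L2_abs vertex_L2_diff u)
  have "energy_norm \<rho> (s n) \<le> energy_norm \<rho> (\<lambda>x. u (Suc n) x - u n x)" for n
    unfolding s_def by (rule finite_energy_contraction(2)[OF finite_energy_diff[OF u_fe u_fe]])
      (auto simp: grad_def)
  then have s_norm: "energy_norm \<rho> (s n) \<le> (1/2) ^ n" for n
    by (rule order_trans) (simp add: cauchy)
  have S: "S N \<in> vertex_L2 \<rho>" for N unfolding S_def by (intro vertex_L2_sum s)
  have S_fe: "S N \<in> finite_energy \<rho>" for N using S by (rule vertex_L2_finite_energy)
  have "energy_norm \<rho> (S N) \<le> 2 - 2 * (1/2) ^ N" for N
  proof (induction N)
    case 0
    show ?case by (simp add: S_def energy_norm_grad grad_def l2norm_def)
  next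
    case (Suc N)
    have "energy_norm \<rho> (\<lambda>x. S N x + s N x) \<le> energy_norm \<rho> (S N) + energy_norm \<rho> (s N)"
      by (rule energy_norm_triangle[OF S_fe vertex_L2_finite_energy(1)[OF s]])
    also have "(\<lambda>x. S N x + s N x) = S (Suc N)" by (simp add: S_def fun_eq_iff)
    finally show ?case using Suc.IH s_norm[of N] by simp
  qed
  then have S_norm: "energy_norm \<rho> (S N) \<le> 2" for N
    by (rule order_trans) simp
  have S_nonneg: "0 \<le> S N x" for N x by (auto simp: S_def s_def intro: sum_nonneg)
  have S_mono: "incseq (\<lambda>N. S N x)" for x by (rule incseq_SucI) (simp add: S_def s_def)
  \<comment> \<open>The recurrent part: the increments of the minimising sequence are not absolutely summable.\<close>
  define Z where "Z = {x. filterlim (\<lambda>N. S N x) at_top sequentially}"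
  have Z: "rho_invariant \<rho> Z" unfolding Z_def by (rule rho_invariant_explosion[OF S_fe S_norm S_mono])
  note Zc = rho_invariant_Compl[OF Z]
  have [measurable]: "Z \<in> sets borel" using Z by (simp add: rho_invariant_def)

  define w where "w n x = indicator (- Z) x * u n x" for n x
  have w: "w n \<in> vertex_L2 \<rho>" for n
    unfolding w_def by (rule vertex_L2_indicator_mult[OF Zc u])
  have w_fe: "w n \<in> finite_energy \<rho>" for n using w by (rule vertex_L2_finite_energy)
  define U where "U x = lim (\<lambda>n. w n x)" for x
  have "convergent (\<lambda>n. w n x)" for x
  proof (cases "x \<in> Z")
    case True
    then show ?thesis by (simp add: w_def convergent_const)
  next
    case False
    obtain B where B: "\<And>N. S N x \<le> B"
    proof (rule ccontr)
      assume "\<not> thesis"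
      then have unb: "\<exists>N. B \<le> S N x" for B using that linear by blast
      have "filterlim (\<lambda>N. S N x) at_top sequentially"
        unfolding filterlim_at_top
      proof
        fix B
        obtain N where "B \<le> S N x" using unb by blast
        then show "eventually (\<lambda>N. B \<le> S N x) sequentially"
          unfolding eventually_sequentially using incseqD[OF S_mono[of x]] order_trans by blast
      qed
      with False show False by (simp add: Z_def)
    qed
    have "summable (\<lambda>n. s n x)"
      using B by (intro summableI_nonneg_bounded[of _ B]) (simp_all add: S_def s_def)
    then have "summable (\<lambda>n. u (Suc n) x - u n x)"
      unfolding s_def by (rule summable_rabs_cancel)
    then have "convergent (\<lambda>N. \<Sum>n<N. u (Suc n) x - u n x)" by (simp add: summable_iff_convergent)
    then have "convergent (\<lambda>N. u N x - u 0 x)" by (simp add: sum_lessThan_telescope[of "\<lambda>n. u n x"])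
    then have "convergent (\<lambda>N. u N x)"
      using convergent_add[OF _ convergent_const[of "u 0 x"], of "\<lambda>N. u N x - u 0 x"] by simp
    with False show ?thesis by (simp add: w_def)
  qed
  then have U: "(\<lambda>n. w n x) \<longlonglongrightarrow> U x" for x
    unfolding U_def by (rule convergent_LIMSEQ_iff[THEN iffD1])
  have [measurable]: "w n \<in> borel_measurable borel" for n using w by (rule vertex_L2D)
  have U_meas [measurable]: "U \<in> borel_measurable borel"
    by (rule borel_measurable_LIMSEQ_real[OF U]) measurable
  \<comment> \<open>Fatou applied to the differences upgrades pointwise convergence to convergence in energy.\<close>
  have U_w: "(\<lambda>x. U x - w m x) \<in> finite_energy \<rho>" "energy_norm \<rho> (\<lambda>x. U x - w m x) \<le> (1/2) ^ m" for m
  proof -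
    have fe: "(\<lambda>x. w (n + m) x - w m x) \<in> finite_energy \<rho>" for n by (intro finite_energy_diff w_fe)
    have "energy_norm \<rho> (\<lambda>x. indicator (- Z) x * (u (n + m) x - u m x))
        \<le> energy_norm \<rho> (\<lambda>x. u (n + m) x - u m x)" for n
      by (rule finite_energy_indicator(2)[OF Zc finite_energy_diff[OF u_fe u_fe]])
    then have "energy_norm \<rho> (\<lambda>x. indicator (- Z) x * (u (n + m) x - u m x)) \<le> (1/2) ^ m" for n
      by (rule order_trans) (simp add: cauchy)
    then have le: "energy_norm \<rho> (\<lambda>x. w (n + m) x - w m x) \<le> (1/2) ^ m" for n
      unfolding w_def right_diff_distrib .
    have lim: "(\<lambda>n. w (n + m) x - w m x) \<longlonglongrightarrow> U x - w m x" for x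
      by (rule tendsto_diff[OF LIMSEQ_ignore_initial_segment[OF U] tendsto_const])
    have meas: "(\<lambda>x. U x - w m x) \<in> borel_measurable borel" by measurable
    from finite_energy_Fatou[OF fe le meas lim]
    show "(\<lambda>x. U x - w m x) \<in> finite_energy \<rho>" "energy_norm \<rho> (\<lambda>x. U x - w m x) \<le> (1/2) ^ m" .
  qed
  have U_fe: "U \<in> finite_energy \<rho>" using finite_energy_add[OF U_w(1)[of 0] w_fe[of 0]] by simp
  have half: "(\<lambda>m. (1/2 :: real) ^ m) \<longlonglongrightarrow> 0" by (rule LIMSEQ_realpow_zero) simp_all
  have U_cl: "U \<in> energy_closure \<rho> (vertex_L2 \<rho>)"
  proof -
    have "\<exists>g\<in>vertex_L2 \<rho>. energy_norm \<rho> (\<lambda>x. U x - g x) < \<epsilon>" if "0 < \<epsilon>" for \<epsilon>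
    proof -
      obtain m where "(1/2 :: real) ^ m < \<epsilon>"
        using order_tendstoD(2)[OF half \<open>0 < \<epsilon>\<close>] by (auto simp: eventually_sequentially)
      then show ?thesis using le_less_trans[OF U_w(2)[of m]] w[of m] by blast
    qed
    with U_fe show ?thesis by (simp add: energy_closure_def)
  qed
  define a where "a x = U x + indicator Z x * f x" for x
  show ?thesis
  proof (rule that[of a])
    show "a \<in> energy_closure \<rho> (vertex_L2 \<rho>)"
      unfolding a_def
    proof (rule energy_closure_add[OF U_cl])
      show "(\<lambda>x. indicator Z x * f x) \<in> energy_closure \<rho> (vertex_L2 \<rho>)"
        by (rule recurrent_approx[OF Z S S_nonneg S_norm _ f]) (simp add: Z_def)
    qed
    fix g assume g: "g \<in> vertex_L2 \<rho>"
    note ge = vertex_L2_finite_energy(1)[OF g]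
    have fu: "(\<lambda>x. f x - u n x) \<in> finite_energy \<rho>" for n by (intro finite_energy_diff f u_fe)
    have eq: "energy_inner \<rho> (\<lambda>x. f x - a x) g
        = energy_inner \<rho> (\<lambda>x. f x - u n x) (\<lambda>x. indicator (- Z) x * g x)
          - energy_inner \<rho> (\<lambda>x. U x - w n x) g" for n
    proof -
      have "(\<lambda>x. f x - a x) = (\<lambda>x. indicator (- Z) x * (f x - u n x) - (U x - w n x))"
        by (auto simp: fun_eq_iff a_def w_def algebra_simps split: split_indicator)
      then show ?thesis
        by (simp only: energy_inner_diff_left[OF finite_energy_indicator(1)[OF Zc fu] U_w(1) ge]
            energy_inner_indicator[OF Zc fu ge])
    qed
    have "(\<lambda>n. energy_inner \<rho> (\<lambda>x. f x - u n x) (\<lambda>x. indicator (- Z) x * g x)) \<longlonglongrightarrow> 0"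
      by (rule orth[OF vertex_L2_indicator_mult[OF Zc g]])
    moreover have "(\<lambda>n. energy_inner \<rho> (\<lambda>x. U x - w n x) g) \<longlonglongrightarrow> 0"
    proof (rule Lim_null_comparison)
      show "eventually (\<lambda>n. norm (energy_inner \<rho> (\<lambda>x. U x - w n x) g) \<le> (1/2) ^ n * energy_norm \<rho> g) sequentially"
        unfolding real_norm_def
        by (intro always_eventually allI order_trans[OF energy_Cauchy_Schwarz[OF U_w(1) ge]]
            mult_right_mono[OF U_w(2) energy_norm_nonneg])
      show "(\<lambda>n. (1/2) ^ n * energy_norm \<rho> g) \<longlonglongrightarrow> 0" by (rule tendsto_mult_left_zero[OF half])
    qed
    ultimately have "(\<lambda>n. energy_inner \<rho> (\<lambda>x. f x - u n x) (\<lambda>x. indicator (- Z) x * g x)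
        - energy_inner \<rho> (\<lambda>x. U x - w n x) g) \<longlonglongrightarrow> 0 - 0"
      by (rule tendsto_diff)
    then have "(\<lambda>n. energy_inner \<rho> (\<lambda>x. f x - a x) g) \<longlonglongrightarrow> 0"
      unfolding eq[symmetric] by simp
    then show "energy_inner \<rho> (\<lambda>x. f x - a x) g = 0" by (simp add: LIMSEQ_const_iff)
  qed
qed

end

section \<open>Harmonic functions\<close>

context symmetric_measure_setting
begin

text \<open>
  The averaged gradient is \<open>h - P h\<close>.  Finite energy is what makes \<open>h\<close> integrable on almost every fibre,
  so that the fibre integral of \<open>h x - h y\<close> can be split.
\<close>

lemma AE_fibre_average_grad:
  assumes h: "h \<in> finite_energy \<rho>"
  shows "AE x in \<mu>. fibre_average K (grad h) x = h x - markov_op K h x"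
proof -
  have [measurable]: "h \<in> borel_measurable borel" using h by (rule finite_energyD)
  have "AE z in \<rho>. fibre_average K (grad h) (fst z) = h (fst z) - fibre_average K (\<lambda>z. h (snd z)) (fst z)"
    using AE_integrable_fibre[OF square_integrableD(2)[OF finite_energyD(2)[OF h]]]
  proof eventually_elim
    fix z :: "'a \<times> 'a"
    let ?x = "fst z"
    interpret prob_space "transition K ?x" by (rule prob_space_transition)
    assume sq: "integrable (transition K ?x) (\<lambda>y. (grad h (?x, y))\<^sup>2)"
    have "integrable (transition K ?x) (\<lambda>y. grad h (?x, y))"
      by (rule square_integrable_imp_integrable[OF _ sq]) (simp add: grad_def)
    then have int: "integrable (transition K ?x) (\<lambda>y. h ?x - grad h (?x, y))" by simp
    then have "integrable (transition K ?x) h" by (simp add: grad_def)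
    then show "fibre_average K (grad h) ?x = h ?x - fibre_average K (\<lambda>z. h (snd z)) ?x"
      using prob_space by (simp add: fibre_average_def grad_def)
  qed
  then have "AE x in \<mu>. fibre_average K (grad h) x = h x - fibre_average K (\<lambda>z. h (snd z)) x"
    by (rule AE_fstD[rotated]) measurable
  moreover have "AE x in \<mu>. markov_op K h x = fibre_average K (\<lambda>z. h (snd z)) x"
    by (rule AE_markov_op_eq) simp
  ultimately show ?thesis by eventually_elim simp
qed

lemma Harm_iff_fibre_average:
  assumes h: "h \<in> finite_energy \<rho>"
  shows "h \<in> Harm \<mu> \<rho> K \<longleftrightarrow> (AE x in \<mu>. fibre_average K (grad h) x = 0)"
proof -
  have "(AE x in \<mu>. markov_op K h x = h x) \<longleftrightarrow> (AE x in \<mu>. fibre_average K (grad h) x = 0)"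
  proof
    assume "AE x in \<mu>. markov_op K h x = h x"
    with AE_fibre_average_grad[OF h] show "AE x in \<mu>. fibre_average K (grad h) x = 0"
      by eventually_elim simp
  next
    assume "AE x in \<mu>. fibre_average K (grad h) x = 0"
    with AE_fibre_average_grad[OF h] show "AE x in \<mu>. markov_op K h x = h x"
      by eventually_elim simp
  qed
  with h show ?thesis by (simp add: Harm_def)
qed

text \<open>
  Because \<open>g\<close> is in \<open>L\<^sup>2(c \<mu>)\<close>, the two terms of \<open>g x - g y\<close> can be integrated separately.  They
  contribute equally, since \<open>\<rho>\<close> is symmetric and the gradient of \<open>h\<close> antisymmetric, which cancels the
  factor \<open>1 / 2\<close> of the energy form.
\<close>

lemma energy_inner_vertex_L2:
  assumes h: "h \<in> finite_energy \<rho>" and g: "g \<in> vertex_L2 \<rho>"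
  shows "energy_inner \<rho> h g = (\<integral>z. grad h z * g (fst z) \<partial>\<rho>)"
proof -
  have [measurable]: "h \<in> borel_measurable borel" "g \<in> borel_measurable borel"
    using finite_energyD(1)[OF h] vertex_L2D(1)[OF g] .
  have int: "integrable \<rho> (\<lambda>z. grad h z * g (fst z))" "integrable \<rho> (\<lambda>z. grad h z * g (snd z))"
    using finite_energyD(2)[OF h] vertex_L2D(2)[OF g] vertex_L2_snd(1)[OF g]
    by (auto intro: integrable_mult_square_integrable)
  have "(\<integral>z. grad h z * g (snd z) \<partial>\<rho>) = (\<integral>z. grad h (snd z, fst z) * g (fst z) \<partial>\<rho>)"
    using integral_swap[of "\<lambda>z. grad h z * g (snd z)"] by simp
  also have "\<dots> = (\<integral>z. - (grad h z * g (fst z)) \<partial>\<rho>)"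
    by (intro Bochner_Integration.integral_cong refl) (simp add: grad_def algebra_simps)
  finally have swap: "(\<integral>z. grad h z * g (snd z) \<partial>\<rho>) = - (\<integral>z. grad h z * g (fst z) \<partial>\<rho>)" by simp
  have "(\<integral>z. grad h z * grad g z \<partial>\<rho>)
      = (\<integral>z. grad h z * g (fst z) - grad h z * g (snd z) \<partial>\<rho>)"
    by (simp add: grad_def[of g] right_diff_distrib)
  also have "\<dots> = 2 * (\<integral>z. grad h z * g (fst z) \<partial>\<rho>)"
    using int by (simp add: swap)
  finally show ?thesis by (simp add: energy_inner_grad)
qed

lemma fibre_average_vertex_L2:
  assumes "F \<in> borel_measurable (borel \<Otimes>\<^sub>M borel)" "square_integrable \<rho> F"
  shows "fibre_average K F \<in> vertex_L2 \<rho>"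
  using assms by (simp add: vertex_L2_def fibre_average_square_integrable measurable_fibre_average)

lemma fibre_average_grad_vertex_L2:
  "h \<in> finite_energy \<rho> \<Longrightarrow> fibre_average K (grad h) \<in> vertex_L2 \<rho>"
  by (intro fibre_average_vertex_L2 measurable_grad) (auto dest: finite_energyD)

text \<open>
  The discrete Green formula \<open>\<langle>h, g\<rangle> = \<integral> c (h - P h) g d\<mu>\<close>.
\<close>

lemma energy_inner_fibre_average:
  assumes h: "h \<in> finite_energy \<rho>" and g: "g \<in> vertex_L2 \<rho>"
  shows "energy_inner \<rho> h g = (\<integral>z. fibre_average K (grad h) (fst z) * g (fst z) \<partial>\<rho>)"
  unfolding energy_inner_vertex_L2[OF h g]
  by (rule integral_mult_fibre_average[OF finite_energyD(2)[OF h] vertex_L2D(2)[OF g]])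

lemma orthogonal_vertex_L2:
  assumes h: "h \<in> finite_energy \<rho>" and orth: "\<And>g. g \<in> D_fin \<mu> \<Longrightarrow> energy_inner \<rho> g h = 0"
    and g: "g \<in> vertex_L2 \<rho>"
  shows "energy_inner \<rho> g h = 0"
proof (rule energy_closure_orthogonal[OF vertex_L2_approx[OF g] _ h orth])
  show "D_fin \<mu> \<subseteq> finite_energy \<rho>"
    using D_fin_subset_vertex_L2 vertex_L2_finite_energy(1) by blast
qed

lemma vertex_L2_eq_0:
  assumes g: "g \<in> vertex_L2 \<rho>" and "(\<integral>z. g (fst z) * g (fst z) \<partial>\<rho>) = 0"
  shows "AE x in \<mu>. g x = 0"
proof (rule AE_fstD)
  have [measurable]: "g \<in> borel_measurable borel" using g by (rule vertex_L2D)
  show "Measurable.pred borel (\<lambda>x. g x = 0)" by measurable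
  show "AE z in \<rho>. g (fst z) = 0"
    using assms(2) by (intro l2norm_eq_0D[OF vertex_L2D(2)[OF g]]) (simp add: l2norm_def power2_eq_square)
qed

lemma Harm_orthogonal:
  assumes h: "h \<in> Harm \<mu> \<rho> K" and g: "g \<in> vertex_L2 \<rho>"
  shows "energy_inner \<rho> h g = 0"
proof -
  have fe: "h \<in> finite_energy \<rho>" using h by (simp add: Harm_def)
  have [measurable]: "h \<in> borel_measurable borel" "g \<in> borel_measurable borel"
    using finite_energyD(1)[OF fe] vertex_L2D(1)[OF g] .
  have "AE z in \<rho>. fibre_average K (grad h) (fst z) = 0"
    using h Harm_iff_fibre_average[OF fe] by (intro AE_fst) simp
  then have "(\<integral>z. fibre_average K (grad h) (fst z) * g (fst z) \<partial>\<rho>) = (\<integral>z. 0 \<partial>\<rho>)"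
    by (intro integral_cong_AE) (auto elim: eventually_mono)
  then show ?thesis by (simp add: energy_inner_fibre_average[OF fe g])
qed

text \<open>
  Test orthogonality with \<open>h - P h\<close> itself, which lies in \<open>L\<^sup>2(c \<mu>)\<close>.
\<close>

lemma Harm_if_orthogonal:
  assumes h: "h \<in> finite_energy \<rho>" and orth: "\<And>g. g \<in> vertex_L2 \<rho> \<Longrightarrow> energy_inner \<rho> h g = 0"
  shows "h \<in> Harm \<mu> \<rho> K"
  unfolding Harm_iff_fibre_average[OF h]
  using orth[OF fibre_average_grad_vertex_L2[OF h]]
  by (intro vertex_L2_eq_0[OF fibre_average_grad_vertex_L2[OF h]])
     (simp add: energy_inner_fibre_average[OF h fibre_average_grad_vertex_L2[OF h]])

lemma markov_op_vertex_L2: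
  assumes g: "g \<in> vertex_L2 \<rho>"
  shows "markov_op K g \<in> vertex_L2 \<rho>"
proof -
  have [measurable]: "g \<in> borel_measurable borel" using g by (rule vertex_L2D)
  have "fibre_average K (\<lambda>z. g (snd z)) \<in> vertex_L2 \<rho>"
    by (rule fibre_average_vertex_L2[OF _ vertex_L2_snd(1)[OF g]]) measurable
  then show ?thesis
    by (rule vertex_L2_bound) (auto simp: markov_op_eq split: split_indicator)
qed

text \<open>
  By the Green formula the left side is \<open>\<integral> c \<phi> (g - P g) d\<mu>\<close> with \<open>\<phi> = h - P h\<close>.  Averaging over the fibres
  moves \<open>P\<close> back into an integral over \<open>\<rho>\<close>, where \<open>g - P g\<close> becomes the gradient of \<open>g\<close>, and the Green
  formula applies once more with \<open>\<phi>\<close> as the test function.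
\<close>

lemma energy_inner_laplacian:
  assumes h: "h \<in> finite_energy \<rho>" and g: "g \<in> vertex_L2 \<rho>"
  shows "energy_inner \<rho> h (\<lambda>x. g x - markov_op K g x) = energy_inner \<rho> g (fibre_average K (grad h))"
proof -
  let ?\<phi> = "fibre_average K (grad h)" and ?Q = "fibre_average K (\<lambda>z. g (snd z))"
  note \<phi> = fibre_average_grad_vertex_L2[OF h]
  note Pg = markov_op_vertex_L2[OF g]
  have [measurable]: "h \<in> borel_measurable borel" "g \<in> borel_measurable borel"
    using finite_energyD(1)[OF h] vertex_L2D(1)[OF g] .
  have ae: "AE z in \<rho>. markov_op K g (fst z) = ?Q (fst z)"
    by (rule AE_fst[OF AE_markov_op_eq]) simp
  have int: "integrable \<rho> (\<lambda>z. ?\<phi> (fst z) * g (fst z))" "integrable \<rho> (\<lambda>z. ?\<phi> (fst z) * markov_op K g (fst z))"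
    "integrable \<rho> (\<lambda>z. g (fst z) * ?\<phi> (fst z))" "integrable \<rho> (\<lambda>z. g (snd z) * ?\<phi> (fst z))"
    by (intro integrable_mult_square_integrable vertex_L2D(2) vertex_L2_snd(1) \<phi> g Pg)+
  have "energy_inner \<rho> h (\<lambda>x. g x - markov_op K g x)
      = (\<integral>z. ?\<phi> (fst z) * (g (fst z) - markov_op K g (fst z)) \<partial>\<rho>)"
    by (rule energy_inner_fibre_average[OF h vertex_L2_diff[OF g Pg]])
  also have "\<dots> = (\<integral>z. ?\<phi> (fst z) * g (fst z) \<partial>\<rho>) - (\<integral>z. ?\<phi> (fst z) * markov_op K g (fst z) \<partial>\<rho>)"
    using int by (simp add: right_diff_distrib)
  also have "(\<integral>z. ?\<phi> (fst z) * markov_op K g (fst z) \<partial>\<rho>) = (\<integral>z. ?Q (fst z) * ?\<phi> (fst z) \<partial>\<rho>)"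
    using ae by (intro integral_cong_AE) (auto elim: eventually_mono)
  also have "\<dots> = (\<integral>z. g (snd z) * ?\<phi> (fst z) \<partial>\<rho>)"
    by (rule integral_mult_fibre_average[symmetric, OF vertex_L2_snd(1)[OF g] vertex_L2D(2)[OF \<phi>]])
  also have "(\<integral>z. ?\<phi> (fst z) * g (fst z) \<partial>\<rho>) - \<dots> = (\<integral>z. grad g z * ?\<phi> (fst z) \<partial>\<rho>)"
    unfolding grad_def left_diff_distrib Bochner_Integration.integral_diff[OF int(3,4)]
    by (simp only: mult.commute)
  also have "\<dots> = energy_inner \<rho> g ?\<phi>"
    by (rule energy_inner_vertex_L2[symmetric, OF vertex_L2_finite_energy(1)[OF g] \<phi>])
  finally show ?thesis .
qed

lemma Harm_iff_orthogonal_laplacian: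
  assumes h: "h \<in> finite_energy \<rho>"
  shows "h \<in> Harm \<mu> \<rho> K \<longleftrightarrow>
    (\<forall>f\<in>D_fin \<mu>. energy_inner \<rho> h (\<lambda>x. f x - markov_op K f x) = 0)"
proof
  assume "h \<in> Harm \<mu> \<rho> K"
  moreover have "(\<lambda>x. f x - markov_op K f x) \<in> vertex_L2 \<rho>" if "f \<in> D_fin \<mu>" for f
    using that D_fin_subset_vertex_L2 by (intro vertex_L2_diff markov_op_vertex_L2) auto
  ultimately show "\<forall>f\<in>D_fin \<mu>. energy_inner \<rho> h (\<lambda>x. f x - markov_op K f x) = 0"
    using Harm_orthogonal by blast
next
  let ?\<phi> = "fibre_average K (grad h)"
  note \<phi> = fibre_average_grad_vertex_L2[OF h]
  note \<phi>_fe = vertex_L2_finite_energy(1)[OF \<phi>]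
  assume orth: "\<forall>f\<in>D_fin \<mu>. energy_inner \<rho> h (\<lambda>x. f x - markov_op K f x) = 0"
  have "energy_inner \<rho> f ?\<phi> = 0" if "f \<in> D_fin \<mu>" for f
    using orth energy_inner_laplacian[OF h, of f] that D_fin_subset_vertex_L2 by auto
  \<comment> \<open>Vanishing energy of phi gives a function that is constant on ergodic components only;
    pairing with h shows that it is zero.\<close>
  then have "energy_inner \<rho> ?\<phi> ?\<phi> = 0" by (rule orthogonal_vertex_L2[OF \<phi>_fe _ \<phi>])
  then have "energy_norm \<rho> ?\<phi> = 0" by (simp add: energy_norm_def)
  then have "energy_inner \<rho> h ?\<phi> = 0" using energy_Cauchy_Schwarz[OF h \<phi>_fe] by simp
  then have "AE x in \<mu>. ?\<phi> x = 0"
    unfolding energy_inner_fibre_average[OF h \<phi>] by (rule vertex_L2_eq_0[OF \<phi>])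
  then show "h \<in> Harm \<mu> \<rho> K" by (simp add: Harm_iff_fibre_average[OF h])
qed

lemma closure_Harm_orthogonal:
  assumes a: "a \<in> energy_closure \<rho> (D_fin \<mu>)" and b: "b \<in> Harm \<mu> \<rho> K"
  shows "energy_inner \<rho> a b = 0"
proof (rule energy_closure_orthogonal)
  show "a \<in> energy_closure \<rho> (vertex_L2 \<rho>)" using a by (simp add: energy_closure_D_fin)
  show "vertex_L2 \<rho> \<subseteq> finite_energy \<rho>" using vertex_L2_finite_energy(1) by blast
  show "b \<in> finite_energy \<rho>" using b by (simp add: Harm_def)
  show "energy_inner \<rho> g b = 0" if "g \<in> vertex_L2 \<rho>" for g
    using Harm_orthogonal[OF b that] by (simp add: energy_inner_commute)
qed

text \<open>
  The splitting of finite energy functions into a potential part and a harmonic part that is known as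
  the Royden decomposition of a network.
\<close>

theorem Royden_decomposition:
  "energy_orthogonal_sum \<rho> (energy_closure \<rho> (D_fin \<mu>)) (Harm \<mu> \<rho> K)"
  unfolding energy_orthogonal_sum_def
proof (intro conjI ballI)
  show "energy_closure \<rho> (D_fin \<mu>) \<subseteq> finite_energy \<rho>" using energy_closure_finite_energy by blast
  show "Harm \<mu> \<rho> K \<subseteq> finite_energy \<rho>" by (auto simp: Harm_def)
next
  fix f assume f: "f \<in> finite_energy \<rho>"
  show "\<exists>a\<in>energy_closure \<rho> (D_fin \<mu>). \<exists>b\<in>Harm \<mu> \<rho> K. f = (\<lambda>x. a x + b x)"
  proof (rule orthogonal_projection_exists[OF f])
    fix a assume a: "a \<in> energy_closure \<rho> (vertex_L2 \<rho>)"
      and orth: "\<And>g. g \<in> vertex_L2 \<rho> \<Longrightarrow> energy_inner \<rho> (\<lambda>x. f x - a x) g = 0"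
    have "(\<lambda>x. f x - a x) \<in> Harm \<mu> \<rho> K"
      by (rule Harm_if_orthogonal[OF finite_energy_diff[OF f energy_closure_finite_energy[OF a]] orth])
    then show ?thesis
      using a unfolding energy_closure_D_fin
      by (intro bexI[of _ a] bexI[of _ "\<lambda>x. f x - a x"]) simp_all
  qed
next
  fix a b assume "a \<in> energy_closure \<rho> (D_fin \<mu>)" "b \<in> Harm \<mu> \<rho> K"
  then show "energy_inner \<rho> a b = 0" by (rule closure_Harm_orthogonal)
next
  fix f assume "f \<in> energy_closure \<rho> (D_fin \<mu>) \<inter> Harm \<mu> \<rho> K"
  then show "energy_norm \<rho> f = 0" by (simp add: energy_norm_def closure_Harm_orthogonal)
qed

end

theorem corollary6p20:
  fixes \<mu> :: "'a::polish_space measure"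
    and \<rho> :: "('a \<times> 'a) measure"
    and E :: "('a \<times> 'a) set"
    and K :: "'a \<Rightarrow> 'a measure"
  assumes "symmetric_measure_setting \<mu> \<rho> E K"
  shows "energy_orthogonal_sum \<rho> (energy_closure \<rho> (D_fin \<mu>)) (Harm \<mu> \<rho> K)
    \<and> (definite_mod_constants \<mu> \<rho> \<longrightarrow>
         (\<forall>f\<in>energy_closure \<rho> (D_fin \<mu>) \<inter> Harm \<mu> \<rho> K. \<exists>k. AE x in \<mu>. f x = k))
    \<and> (\<forall>h\<in>finite_energy \<rho>.
         h \<in> Harm \<mu> \<rho> K \<longleftrightarrow>
         (\<forall>f\<in>D_fin \<mu>. energy_inner \<rho> h (\<lambda>x. f x - markov_op K f x) = 0))"
proof (intro conjI impI ballI)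
  interpret symmetric_measure_setting \<mu> \<rho> E K by (rule assms)
  show sum: "energy_orthogonal_sum \<rho> (energy_closure \<rho> (D_fin \<mu>)) (Harm \<mu> \<rho> K)"
    by (rule Royden_decomposition)
  show "\<exists>k. AE x in \<mu>. f x = k"
    if "definite_mod_constants \<mu> \<rho>" "f \<in> energy_closure \<rho> (D_fin \<mu>) \<inter> Harm \<mu> \<rho> K" for f
    using that sum unfolding definite_mod_constants_def energy_orthogonal_sum_def by blast
  show "h \<in> Harm \<mu> \<rho> K \<longleftrightarrow>
      (\<forall>f\<in>D_fin \<mu>. energy_inner \<rho> h (\<lambda>x. f x - markov_op K f x) = 0)"
    if "h \<in> finite_energy \<rho>" for h
    by (rule Harm_iff_orthogonal_laplacian[OF that])
qed

end
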